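(* If $D$ is a Noetherian TAF-domain, then every overring of $D$ is also a Noetherian TAF-domain.
   Context: An overring of a domain $D$ is a ring between $D$ and its quotient field. An ideal $I$ of a commutative ring $R$ is a 2-absorbing ideal (TA-ideal) if whenever $a,b,c\in R$ and $abc\in I$, then $ab\in I$ or $ac\in I$ or $bc\in I$. A TA-factorization of an ideal $I$ is an expression $I=J_1\cdots J_n$ as a product of proper TA-ideals. A TAF-domain is an integral domain in which every proper ideal has a TA-factorization. *)

theory Defs
  imports "HOL-Algebra.Algebra"
begin

definition TA_ideal :: "'a set \<Rightarrow> ('a, 'b) ring_scheme \<Rightarrow> bool" where
  "TA_ideal I R \<longleftrightarrow> ideal I R \<and>
     (\<forall>a \<in> carrier R. \<forall>b \<in> carrier R. \<forall>c \<in> carrier R.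
        a \<otimes>\<^bsub>R\<^esub> b \<otimes>\<^bsub>R\<^esub> c \<in> I \<longrightarrow>
        a \<otimes>\<^bsub>R\<^esub> b \<in> I \<or> a \<otimes>\<^bsub>R\<^esub> c \<in> I \<or> b \<otimes>\<^bsub>R\<^esub> c \<in> I)"

text \<open>The unit ideal \<^term>\<open>carrier R\<close> is the neutral element of the product of ideals, so the
  fold below is the product \<open>J\<^sub>1 \<cdots> J\<^sub>n\<close> for \<open>Js = [J\<^sub>1, \<dots>, J\<^sub>n]\<close>.\<close>

definition TA_factorization :: "('a, 'b) ring_scheme \<Rightarrow> 'a set \<Rightarrow> 'a set list \<Rightarrow> bool" where
  "TA_factorization R I Js \<longleftrightarrow> Js \<noteq> [] \<and>
     (\<forall>J \<in> set Js. TA_ideal J R \<and> J \<noteq> carrier R) \<and>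
     I = foldr (ideal_prod R) Js (carrier R)"

locale TAF_domain = domain +
  assumes exists_TA_factorization:
    "\<lbrakk> ideal I R; I \<noteq> carrier R \<rbrakk> \<Longrightarrow> \<exists>Js. TA_factorization R I Js"

text \<open>Integral domains and their overrings are represented as subrings \<open>S\<close> of an ambient field \<open>K\<close>;
  the ring structure on \<open>S\<close> is \<^term>\<open>K\<lparr>carrier := S\<rparr>\<close>.\<close>

definition is_quotient_field :: "('a, 'b) ring_scheme \<Rightarrow> 'a set \<Rightarrow> bool" where
  "is_quotient_field K D \<longleftrightarrow> field K \<and> subring D K \<and>
     (\<forall>x \<in> carrier K. \<exists>a \<in> D. \<exists>b \<in> D - {\<zero>\<^bsub>K\<^esub>}. x = a \<otimes>\<^bsub>K\<^esub> inv\<^bsub>K\<^esub> b)"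

definition overring :: "('a, 'b) ring_scheme \<Rightarrow> 'a set \<Rightarrow> 'a set \<Rightarrow> bool" where
  "overring K D S \<longleftrightarrow> is_quotient_field K D \<and> subring S K \<and> D \<subseteq> S"

end

theory Submission
  imports Defs
begin

text \<open>A Noetherian domain \<open>D\<close> is a TAF-domain iff \<open>M\<^sup>2D\<^sub>M \<subseteq> xD\<^sub>M\<close> for all nonzero maximal ideals \<open>M\<close>
  and all \<open>x \<in> M - M\<^sup>2\<close>. In one direction, the TA-factorization of \<open>xD + M\<^sup>3\<close> can have only one
  factor. In the other, the condition forces dimension at most one, so a nonzero ideal is a product
  of ideals \<open>Q\<close> containing powers of maximal ideals \<open>M\<close>. If \<open>Q\<close> is not contained in \<open>M\<^sup>2\<close>, it contains
  \<open>M\<^sup>2\<close> and is a TA-ideal; otherwise the TA-ideal \<open>xD + M\<^sup>2\<close> can be split off.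

  The condition makes \<open>x\<^sup>-\<^sup>1MD\<^sub>M\<close> a valuation ring with maximal ideal \<open>MD\<^sub>M\<close>. If \<open>N\<close> is a nonzero maximal
  ideal of an overring \<open>S\<close> and \<open>M = N \<inter> D\<close>, it follows that \<open>N\<close> and \<open>M\<close> generate the same maximal ideal
  locally, so the condition passes from \<open>D\<close> to \<open>S\<close>; that \<open>S\<close> is Noetherian is Krull-Akizuki.\<close>

section \<open>Powers, saturations and Noetherian induction\<close>

text \<open>Localizations of \<open>D\<close> are never constructed. An ideal of the localization at
  \<open>M\<close> is represented by its contraction, a saturated ideal of \<open>D\<close>, and
  local equations carry a factor outside \<open>M\<close>. For ideals containing a power of
  \<open>M\<close> this loses nothing. The engine is that the local condition sharpens itself: if s
  p = x q with p in M^2 and s outside \<open>M\<close>, then q lies in \<open>M\<close>, since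
  otherwise x would lie in M^2. So locally M^2 = x M, and repeated division by \<open>x\<close>
  reduces every nonzero element of \<open>M\<close> to one of M - M^2. This works although
  \<open>M\<close> need not be locally principal. For overrings the obstacle is that
  \<open>S\<close> need not be integral over \<open>D\<close>, so integrality says nothing about
  \<open>N\<close>. It is replaced by a dichotomy in \<open>K\<close>: z lies in \<open>V\<close> or
  1/z lies in the local maximal ideal. If a in \<open>N\<close> were outside that ideal, all powers
  of 1/a would lie in \<open>V\<close>, hence have \<open>x\<close> as a common denominator, and the
  ascending chain condition in \<open>D\<close> would then force an element of D - M into
  \<open>N\<close>.\<close>

lemma (in ring) ideal_sum_iff: "x \<in> I <+>\<^bsub>R\<^esub> J \<longleftrightarrow> (\<exists>i\<in>I. \<exists>j\<in>J. x = i \<oplus> j)"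
  unfolding set_add_def' by auto

lemma (in ring) ideal_prod_subset:
  assumes "ideal B R" "\<And>i j. i \<in> I \<Longrightarrow> j \<in> J \<Longrightarrow> i \<otimes> j \<in> B"
  shows "I \<cdot> J \<subseteq> B"
proof
  interpret B: ideal B R by fact
  fix x assume "x \<in> I \<cdot> J"
  then show "x \<in> B" by induction (auto simp: assms)
qed

lemma ideal_prod_mono: "I \<subseteq> I' \<Longrightarrow> J \<subseteq> J' \<Longrightarrow> ideal_prod R I J \<subseteq> ideal_prod R I' J'"
proof
  fix x assume "x \<in> ideal_prod R I J" and "I \<subseteq> I'" "J \<subseteq> J'"
  then show "x \<in> ideal_prod R I' J'"
    by induction (auto intro: ideal_prod.intros)
qed

lemma (in ring) ideal_sum_upper:
  assumes "ideal I R" "ideal J R"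
  shows "I \<subseteq> I <+>\<^bsub>R\<^esub> J" "J \<subseteq> I <+>\<^bsub>R\<^esub> J"
proof -
  interpret I: ideal I R by fact
  interpret J: ideal J R by fact
  show "I \<subseteq> I <+>\<^bsub>R\<^esub> J" "J \<subseteq> I <+>\<^bsub>R\<^esub> J"
    using I.zero_closed J.zero_closed I.Icarr J.Icarr
    by (metis subsetI ideal_sum_iff r_zero, metis subsetI ideal_sum_iff l_zero)
qed

lemma (in ring) ideal_sum_least:
  assumes "ideal B R" "I \<subseteq> B" "J \<subseteq> B"
  shows "I <+>\<^bsub>R\<^esub> J \<subseteq> B"
proof -
  interpret B: ideal B R by fact
  show ?thesis using assms unfolding set_add_def' by auto
qed

lemma (in ring) ideal_minus_closed:
  assumes "ideal I R" "a \<in> I" "b \<in> I"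
  shows "a \<ominus> b \<in> I"
proof -
  interpret I: ideal I R by fact
  show ?thesis using assms by (simp add: a_minus_def)
qed

primrec ideal_pow :: "('a, 'b) ring_scheme \<Rightarrow> 'a set \<Rightarrow> nat \<Rightarrow> 'a set" where
  "ideal_pow R I 0 = carrier R"
| "ideal_pow R I (Suc n) = ideal_prod R I (ideal_pow R I n)"

lemma (in ring) ideal_pow_ideal: "ideal I R \<Longrightarrow> ideal (ideal_pow R I n) R"
  by (induction n) (auto intro: oneideal ideal_prod_is_ideal)

lemma (in ring) ideal_pow_one: "ideal I R \<Longrightarrow> ideal_pow R I (Suc 0) = I"
  by (simp add: ideal_prod_one)

lemma (in ring) ideal_pow_two: "ideal I R \<Longrightarrow> ideal_pow R I 2 = I \<cdot> I"
  by (simp add: ideal_prod_one numeral_2_eq_2)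

lemma (in cring) ideal_pow_add:
  assumes "ideal I R"
  shows "ideal_pow R I (m + n) = ideal_pow R I m \<cdot> ideal_pow R I n"
proof (induction m)
  case 0
  show ?case
    using ideal_prod_commute[OF oneideal ideal_pow_ideal[OF assms]]
    by (simp add: ideal_prod_one ideal_pow_ideal assms)
next
  case (Suc m)
  then show ?case by (simp add: ideal_prod_assoc ideal_pow_ideal assms)
qed

lemma (in cring) ideal_pow_antimono:
  assumes "ideal I R" "m \<le> n"
  shows "ideal_pow R I n \<subseteq> ideal_pow R I m"
proof -
  have "ideal_pow R I n = ideal_pow R I m \<cdot> ideal_pow R I (n - m)"
    using ideal_pow_add[OF assms(1), of m "n - m"] assms(2) by simp
  then show ?thesis
    using ideal_prod_inter[OF ideal_pow_ideal[OF assms(1), of m] ideal_pow_ideal[OF assms(1), of "n - m"]]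
    by simp
qed

lemma (in cring) ideal_pow_subset_prime:
  assumes "primeideal P R" "ideal I R" "ideal_pow R I n \<subseteq> P"
  shows "I \<subseteq> P"
  using assms(3)
proof (induction n)
  case 0
  interpret P: primeideal P R by fact
  show ?case using 0 P.I_notcarr P.a_subset by (metis ideal_pow.simps(1) subset_antisym)
next
  case (Suc n)
  then show ?case
    using primeideal_divides_ideal_prod[OF assms(1,2) ideal_pow_ideal[OF assms(2)]] by auto
qed

lemma (in cring) maximalideal_witness:
  assumes "maximalideal M R" "s \<in> carrier R" "s \<notin> M"
  obtains r where "r \<in> carrier R" "\<one> \<ominus> r \<otimes> s \<in> M"
proof -
  interpret M: maximalideal M R by fact
  have id: "ideal (M <+> PIdl s) R"
    by (intro add_ideals M.is_ideal cgenideal_ideal assms)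
  have "M \<subseteq> M <+> PIdl s" "s \<in> M <+> PIdl s"
    using ideal_sum_upper[OF M.is_ideal cgenideal_ideal[OF assms(2)]] cgenideal_self[OF assms(2)] by auto
  then have "M <+> PIdl s = carrier R"
    using M.I_maximal[OF id] ideal.Icarr[OF id] assms(3) by auto
  then have "\<one> \<in> M <+> PIdl s" by simp
  then obtain m r where mr: "m \<in> M" "r \<in> carrier R" "\<one> = m \<oplus> r \<otimes> s"
    by (auto simp: ideal_sum_iff cgenideal_def)
  have "\<one> \<ominus> r \<otimes> s = m"
    using mr M.Icarr[OF mr(1)] assms(2) by algebra
  then show ?thesis using that mr by auto
qed

text \<open>A product of two elements of the form 1 - r s again has this form, so an inverse of
  \<open>s\<close> modulo \<open>M\<close> lifts to one modulo every power of
  \<open>M\<close>.\<close>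

lemma (in cring) maximalideal_pow_witness:
  assumes M: "maximalideal M R" and s: "s \<in> carrier R" "s \<notin> M"
  shows "\<exists>r\<in>carrier R. \<one> \<ominus> r \<otimes> s \<in> ideal_pow R M n"
proof (induction n)
  case 0
  then show ?case using s by auto
next
  case (Suc n)
  then obtain r where r: "r \<in> carrier R" "\<one> \<ominus> r \<otimes> s \<in> ideal_pow R M n" by auto
  obtain q where q: "q \<in> carrier R" "\<one> \<ominus> q \<otimes> s \<in> M"
    using maximalideal_witness[OF M s] by auto
  have "(\<one> \<ominus> q \<otimes> s) \<otimes> (\<one> \<ominus> r \<otimes> s) = \<one> \<ominus> (q \<oplus> r \<ominus> q \<otimes> r \<otimes> s) \<otimes> s"
    using r(1) q(1) s(1) by algebra
  then have "\<one> \<ominus> (q \<oplus> r \<ominus> q \<otimes> r \<otimes> s) \<otimes> s \<in> ideal_pow R M (Suc n)"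
    using ideal_prod.prod[OF q(2) r(2), of R] by simp
  then show ?case using r(1) q(1) s(1) by (meson a_closed m_closed minus_closed)
qed

text \<open>An ideal containing a power of \<open>M\<close> is the contraction of its localization at \<open>M\<close>.\<close>

lemma (in cring) mem_of_mult_mem:
  assumes M: "maximalideal M R" and s: "s \<in> carrier R" "s \<notin> M"
    and J: "ideal J R" "ideal_pow R M n \<subseteq> J"
    and d: "d \<in> carrier R" "s \<otimes> d \<in> J"
  shows "d \<in> J"
proof -
  interpret J: ideal J R by fact
  obtain r where r: "r \<in> carrier R" "\<one> \<ominus> r \<otimes> s \<in> ideal_pow R M n"
    using maximalideal_pow_witness[OF M s] by blast
  have "d = (\<one> \<ominus> r \<otimes> s) \<otimes> d \<oplus> r \<otimes> (s \<otimes> d)"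
    using r(1) s(1) d(1) by algebra
  moreover have "(\<one> \<ominus> r \<otimes> s) \<otimes> d \<in> J" using r J d(1) J.I_r_closed by blast
  moreover have "r \<otimes> (s \<otimes> d) \<in> J" using r d J.I_l_closed by blast
  ultimately show ?thesis by (metis J.a_closed)
qed

text \<open>The contraction to \<open>R\<close> of the extension of \<open>B\<close> to the
  localization at \<open>M\<close>, written without fractions.\<close>

definition saturation :: "('a, 'b) ring_scheme \<Rightarrow> 'a set \<Rightarrow> 'a set \<Rightarrow> 'a set" where
  "saturation R M B = {d \<in> carrier R. \<exists>s \<in> carrier R - M. s \<otimes>\<^bsub>R\<^esub> d \<in> B}"

context primeideal
begin

lemma one_notin: "\<one> \<notin> I"
  using one_imp_carrier I_notcarr by auto

lemma mult_notin: "s \<in> carrier R - I \<Longrightarrow> t \<in> carrier R - I \<Longrightarrow> s \<otimes> t \<in> carrier R - I"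
  using I_prime by auto

lemma saturation_ideal:
  assumes "ideal B R" shows "ideal (saturation R I B) R"
proof -
  interpret B: ideal B R by fact
  have mult: "x \<otimes> d \<in> saturation R I B" if d: "d \<in> saturation R I B" and x: "x \<in> carrier R" for d x
  proof -
    obtain s where s: "s \<in> carrier R - I" "s \<otimes> d \<in> B" "d \<in> carrier R"
      using d unfolding saturation_def by auto
    have "s \<otimes> (x \<otimes> d) = x \<otimes> (s \<otimes> d)" using s x by (simp add: m_lcomm)
    then have "s \<otimes> (x \<otimes> d) \<in> B" using B.I_l_closed[OF s(2) x] by simp
    then show ?thesis unfolding saturation_def using s x by auto
  qed
  show ?thesis
  proof (rule idealI[OF ring_axioms])
    show "subgroup (saturation R I B) (add_monoid R)"
    proof (rule add.subgroupI)
      show "saturation R I B \<subseteq> carrier R" by (auto simp: saturation_def)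
      have "\<zero> \<in> saturation R I B" unfolding saturation_def using one_notin by force
      then show "saturation R I B \<noteq> {}" by auto
    next
      fix a assume a: "a \<in> saturation R I B"
      then have "\<ominus> a = (\<ominus> \<one>) \<otimes> a" by (simp add: saturation_def l_minus)
      then show "\<ominus> a \<in> saturation R I B" using mult[OF a, of "\<ominus> \<one>"] by simp
    next
      fix a b assume "a \<in> saturation R I B" "b \<in> saturation R I B"
      then obtain s t where s: "s \<in> carrier R - I" "s \<otimes> a \<in> B" "a \<in> carrier R"
        and t: "t \<in> carrier R - I" "t \<otimes> b \<in> B" "b \<in> carrier R"
        unfolding saturation_def by auto
      have "(s \<otimes> t) \<otimes> (a \<oplus> b) = t \<otimes> (s \<otimes> a) \<oplus> s \<otimes> (t \<otimes> b)"
        using s t by (simp add: r_distr m_ac)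
      also have "\<dots> \<in> B" using s t B.I_l_closed by auto
      finally show "a \<oplus> b \<in> saturation R I B"
        unfolding saturation_def using mult_notin[OF s(1) t(1)] s(3) t(3) by blast
    qed
  next
    fix a x assume a: "a \<in> saturation R I B" and x: "x \<in> carrier R"
    show "x \<otimes> a \<in> saturation R I B" by (rule mult[OF a x])
    moreover have "a \<otimes> x = x \<otimes> a" using a x by (simp add: saturation_def m_comm)
    ultimately show "a \<otimes> x \<in> saturation R I B" by simp
  qed
qed

lemma saturation_increasing: "B \<subseteq> carrier R \<Longrightarrow> B \<subseteq> saturation R I B"
  unfolding saturation_def using one_notin by force

lemma saturation_mono: "B \<subseteq> C \<Longrightarrow> saturation R I B \<subseteq> saturation R I C"
  unfolding saturation_def by auto

lemma saturation_memI:
  "d \<in> carrier R \<Longrightarrow> s \<in> carrier R - I \<Longrightarrow> s \<otimes> d \<in> B \<Longrightarrow> d \<in> saturation R I B"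
  unfolding saturation_def by auto

lemma saturation_memE:
  assumes "d \<in> saturation R I B"
  obtains s where "d \<in> carrier R" "s \<in> carrier R - I" "s \<otimes> d \<in> B"
  using assms unfolding saturation_def by auto

lemma saturation_mult_memD:
  assumes "d \<in> carrier R" "s \<in> carrier R - I" "s \<otimes> d \<in> saturation R I B"
  shows "d \<in> saturation R I B"
proof -
  obtain t where t: "t \<in> carrier R - I" "t \<otimes> (s \<otimes> d) \<in> B"
    using assms(3) by (rule saturation_memE)
  have "t \<otimes> s \<in> carrier R - I" "(t \<otimes> s) \<otimes> d \<in> B"
    using t assms mult_notin by (auto simp: m_assoc)
  then show ?thesis using assms(1) by (auto intro: saturation_memI)
qed

end

text \<open>The ideal quotient B : A. It serves as division by an element and, in
  \<open>split_off_primary\<close>, as the comaximal cofactor.\<close>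

lemma (in cring) colon_ideal:
  assumes "ideal B R" "A \<subseteq> carrier R"
  shows "ideal {d \<in> carrier R. \<forall>a\<in>A. a \<otimes> d \<in> B} R"
proof -
  interpret B: ideal B R by fact
  have [simp]: "\<And>a. a \<in> A \<Longrightarrow> a \<in> carrier R" using assms by auto
  show ?thesis
  proof (rule idealI[OF ring_axioms])
    show "subgroup {d \<in> carrier R. \<forall>a\<in>A. a \<otimes> d \<in> B} (add_monoid R)"
    proof (rule add.subgroupI)
      have "\<zero> \<in> {d \<in> carrier R. \<forall>a\<in>A. a \<otimes> d \<in> B}" using B.zero_closed by simp
      then show "{d \<in> carrier R. \<forall>a\<in>A. a \<otimes> d \<in> B} \<noteq> {}" by blast
    qed (auto simp: r_distr r_minus)
  next
    fix d x assume d: "d \<in> {d \<in> carrier R. \<forall>a\<in>A. a \<otimes> d \<in> B}" and x: "x \<in> carrier R"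
    have "a \<otimes> (x \<otimes> d) \<in> B" if "a \<in> A" for a
    proof -
      have "a \<otimes> (x \<otimes> d) = x \<otimes> (a \<otimes> d)" using that d x m_lcomm by auto
      then show ?thesis using B.I_l_closed[of "a \<otimes> d" x] that d x by auto
    qed
    then show "x \<otimes> d \<in> {d \<in> carrier R. \<forall>a\<in>A. a \<otimes> d \<in> B}" using d x by auto
  next
    fix a x assume "a \<in> {d \<in> carrier R. \<forall>a\<in>A. a \<otimes> d \<in> B}" "x \<in> carrier R"
    then show "a \<otimes> x \<in> {d \<in> carrier R. \<forall>a\<in>A. a \<otimes> d \<in> B}"
      using B.I_r_closed by (simp flip: m_assoc)
  qed
qed

text \<open>A nonempty chain of ideals contains its own union, so Zorn's lemma applies to an
  arbitrary property \<open>P\<close>, whether or not it passes to unions.\<close>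

lemma (in noetherian_ring) exists_maximal_ideal_with:
  assumes "ideal I R" "P I"
  obtains U where "ideal U R" "P U" "\<And>J. ideal J R \<Longrightarrow> P J \<Longrightarrow> U \<subseteq> J \<Longrightarrow> J = U"
proof -
  let ?F = "{J. ideal J R \<and> P J}"
  have "?F \<noteq> {}" using assms by auto
  then have "\<exists>U\<in>?F. \<forall>J\<in>?F. U \<subseteq> J \<longrightarrow> J = U"
  proof (rule subset_Zorn_nonempty)
    fix C assume C: "C \<noteq> {}" "subset.chain ?F C"
    then have "subset.chain {I. ideal I R} C" unfolding pred_on.chain_def by auto
    then show "\<Union>C \<in> ?F" using ideal_chain_is_trivial[OF C(1)] C(2) unfolding pred_on.chain_def by auto
  qed
  then show ?thesis using that by auto
qed

lemma (in noetherian_ring) noetherian_induct [consumes 1, case_names step]: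
  assumes "ideal I R"
    and step: "\<And>I. ideal I R \<Longrightarrow> (\<And>J. ideal J R \<Longrightarrow> I \<subset> J \<Longrightarrow> P J) \<Longrightarrow> P I"
  shows "P I"
proof (rule ccontr)
  assume "\<not> P I"
  then obtain U where "ideal U R" "\<not> P U" "\<And>J. ideal J R \<Longrightarrow> \<not> P J \<Longrightarrow> U \<subseteq> J \<Longrightarrow> J = U"
    using exists_maximal_ideal_with[of I "\<lambda>I. \<not> P I"] assms(1) by blast
  then show False using step by (metis psubsetE order_refl)
qed

lemma (in noetherian_ring) ideal_sequence_stable:
  fixes f :: "nat \<Rightarrow> 'a set"
  assumes "\<And>n. ideal (f n) R" "\<And>n. f n \<subseteq> f (Suc n)"
  obtains n where "f (Suc n) = f n"
proof -
  obtain U where U: "U \<in> range f" "\<And>J. ideal J R \<Longrightarrow> J \<in> range f \<Longrightarrow> U \<subseteq> J \<Longrightarrow> J = U"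
    by (rule exists_maximal_ideal_with[OF assms(1)[of 0], of "\<lambda>J. J \<in> range f"]) auto
  then obtain n where "U = f n" by auto
  then have "f (Suc n) = f n" using U(2)[OF assms(1)[of "Suc n"]] assms(2)[of n] by simp
  then show ?thesis by (rule that)
qed

lemma (in noetherian_ring) exists_maximalideal:
  assumes "ideal I R" "I \<noteq> carrier R"
  obtains M where "maximalideal M R" "I \<subseteq> M"
proof -
  obtain M where M: "ideal M R" "M \<noteq> carrier R \<and> I \<subseteq> M"
     "\<And>J. ideal J R \<Longrightarrow> J \<noteq> carrier R \<and> I \<subseteq> J \<Longrightarrow> M \<subseteq> J \<Longrightarrow> J = M"
    using exists_maximal_ideal_with[of I "\<lambda>M. M \<noteq> carrier R \<and> I \<subseteq> M"] assms by blast
  have "maximalideal M R"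
    by (rule maximalidealI) (use M in blast)+
  then show ?thesis using that M by auto
qed

section \<open>Locally pseudo-valuation domains\<close>

text \<open>Nakayama's lemma over the localization at \<open>M\<close>.\<close>

lemma (in noetherian_domain) nakayama:
  assumes M: "primeideal M R" and N: "ideal N R" and B: "ideal B R"
    and sub: "N \<subseteq> B <+>\<^bsub>R\<^esub> M \<cdot> N"
  shows "N \<subseteq> saturation R M B"
proof (rule ccontr)
  assume neg: "\<not> N \<subseteq> saturation R M B"
  interpret M: primeideal M R by fact
  interpret N: ideal N R by fact
  interpret B: ideal B R by fact
  \<comment> \<open>An ideal \<open>U\<close> maximal among the saturated ideals that contain
    \<open>B\<close> but not \<open>N\<close> turns out to contain \<open>M \<cdot> N\<close>, hence
    by \<open>sub\<close> all of \<open>N\<close>.\<close>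
  let ?P = "\<lambda>U. saturation R M U \<subseteq> U \<and> B \<subseteq> U \<and> \<not> N \<subseteq> U"
  have idem: "saturation R M (saturation R M U) \<subseteq> saturation R M U" for U
    using M.saturation_mult_memD by (meson M.saturation_memE subsetI)
  have "?P (saturation R M B)"
    using idem M.saturation_increasing[OF B.a_subset] neg by auto
  then obtain U where U: "ideal U R" "saturation R M U \<subseteq> U" "B \<subseteq> U" "\<not> N \<subseteq> U"
    and max: "\<And>J. ideal J R \<Longrightarrow> ?P J \<Longrightarrow> U \<subseteq> J \<Longrightarrow> J = U"
    using exists_maximal_ideal_with[of _ ?P] M.saturation_ideal[OF B] by metis
  interpret U: ideal U R by fact
  have "m \<otimes> a \<in> U" if m: "m \<in> M" and a: "a \<in> N" for m a
  proof (rule ccontr)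
    assume ma: "m \<otimes> a \<notin> U"
    have mc: "m \<in> carrier R" and ac: "a \<in> carrier R" using m a M.Icarr N.Icarr by auto
    let ?V = "U <+>\<^bsub>R\<^esub> PIdl (m \<otimes> a)"
    let ?W = "saturation R M ?V"
    have pid: "ideal (PIdl (m \<otimes> a)) R" using mc ac cgenideal_ideal by auto
    have V: "ideal ?V R" by (intro add_ideals U(1) pid)
    interpret V: ideal ?V R by fact
    have UV: "U \<subseteq> ?V" "m \<otimes> a \<in> ?V"
      using ideal_sum_upper[OF U(1) pid] cgenideal_self mc ac by auto
    have VW: "?V \<subseteq> ?W" by (rule M.saturation_increasing[OF V.a_subset])
    have "?W \<noteq> U" using UV VW ma by auto
    then have "\<not> ?P ?W" using max[OF M.saturation_ideal[OF V]] UV VW by blast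
    then have "a \<in> ?W" using idem U(3) UV VW a by blast
    then obtain s where s: "s \<in> carrier R - M" "s \<otimes> a \<in> ?V"
      by (rule M.saturation_memE)
    then obtain u v where "u \<in> U" "v \<in> PIdl (m \<otimes> a)" "s \<otimes> a = u \<oplus> v"
      unfolding ideal_sum_iff by blast
    then obtain r where ur: "u \<in> U" "r \<in> carrier R" "s \<otimes> a = u \<oplus> r \<otimes> (m \<otimes> a)"
      unfolding cgenideal_def by blast
    have uc: "u \<in> carrier R" and sc: "s \<in> carrier R" using ur s U.Icarr by auto
    \<comment> \<open>The coefficient s - r m is outside \<open>M\<close> because m is inside, so
      the saturated ideal \<open>U\<close> allows it to be cancelled.\<close>
    have "(s \<ominus> r \<otimes> m) \<otimes> a = s \<otimes> a \<ominus> r \<otimes> (m \<otimes> a)"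
      using sc ur(2) mc ac by algebra
    also have "\<dots> = u"
      unfolding ur(3) using uc ur(2) mc ac by algebra
    finally have "(s \<ominus> r \<otimes> m) \<otimes> a \<in> U" using ur(1) by simp
    moreover have "s \<ominus> r \<otimes> m \<in> carrier R - M"
    proof -
      have "s = (s \<ominus> r \<otimes> m) \<oplus> r \<otimes> m" using sc ur(2) mc by algebra
      moreover have "r \<otimes> m \<in> M" using M.I_l_closed m ur(2) by auto
      ultimately have "s \<ominus> r \<otimes> m \<notin> M" using s(1) M.a_closed by (metis DiffD2)
      then show ?thesis using s(1) ur(2) mc by auto
    qed
    ultimately have "a \<in> U" using U(2) M.saturation_memI[OF ac] by auto
    then show False using ma U.I_l_closed mc by auto
  qed
  then have "M \<cdot> N \<subseteq> U" by (rule ideal_prod_subset[OF U(1)])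
  then have "N \<subseteq> U" using sub ideal_sum_least[OF U(1) U(3)] by blast
  then show False using U(4) by simp
qed

text \<open>Nakayama's lemma for the zero ideal: M = M^2 would put \<open>M\<close> into the
  saturation of zero, which is zero in a domain.\<close>

lemma (in noetherian_domain) prime_square_proper:
  assumes M: "primeideal M R" and "M \<noteq> {\<zero>}"
  obtains x where "x \<in> M - M \<cdot> M"
proof -
  interpret M: primeideal M R by fact
  have "M \<subseteq> M \<cdot> M \<Longrightarrow> M \<subseteq> {\<zero>}"
  proof -
    assume sub: "M \<subseteq> M \<cdot> M"
    have "M \<cdot> M \<subseteq> {\<zero>} <+>\<^bsub>R\<^esub> M \<cdot> M"
      by (rule ideal_sum_upper(2)[OF zeroideal ideal_prod_is_ideal[OF M.is_ideal M.is_ideal]])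
    then have "M \<subseteq> saturation R M {\<zero>}"
      using nakayama[OF M M.is_ideal zeroideal] sub by blast
    then show "M \<subseteq> {\<zero>}"
      using M.zero_closed integral unfolding saturation_def by blast
  qed
  then show ?thesis using that assms(2) M.zero_closed by blast
qed

text \<open>For Noetherian domains this says that every localization \<open>R\<^sub>M\<close> at a nonzero maximal ideal is a
  pseudo-valuation domain whose valuation overring is discrete.\<close>

definition locally_pseudo_valuation :: "('a, 'b) ring_scheme \<Rightarrow> bool" where
  "locally_pseudo_valuation R \<longleftrightarrow>
     (\<forall>M. maximalideal M R \<longrightarrow> M \<noteq> {\<zero>\<^bsub>R\<^esub>} \<longrightarrow>
        (\<forall>x \<in> M - ideal_prod R M M. ideal_prod R M M \<subseteq> saturation R M (PIdl\<^bsub>R\<^esub> x)))"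

section \<open>Necessity of the local condition\<close>

lemma (in ring) foldr_ideal_prod_ideal:
  "(\<And>J. J \<in> set Js \<Longrightarrow> ideal J R) \<Longrightarrow> ideal (foldr (ideal_prod R) Js (carrier R)) R"
  by (induction Js) (auto intro: oneideal ideal_prod_is_ideal)

lemma (in ring) foldr_ideal_prod_subset:
  "(\<And>J. J \<in> set Js \<Longrightarrow> ideal J R) \<Longrightarrow> J \<in> set Js \<Longrightarrow> foldr (ideal_prod R) Js (carrier R) \<subseteq> J"
proof (induction Js)
  case Nil
  then show ?case by simp
next
  case (Cons K Js)
  have "ideal K R" "ideal (foldr (ideal_prod R) Js (carrier R)) R"
    using Cons.prems(1) by (auto intro: foldr_ideal_prod_ideal)
  from ideal_prod_inter[OF this] show ?case using Cons by force
qed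

lemma (in cring) foldr_ideal_prod_append:
  assumes "\<And>J. J \<in> set Js \<Longrightarrow> ideal J R" "\<And>J. J \<in> set Ks \<Longrightarrow> ideal J R"
  shows "foldr (ideal_prod R) (Js @ Ks) (carrier R) =
           foldr (ideal_prod R) Js (carrier R) \<cdot> foldr (ideal_prod R) Ks (carrier R)"
  using assms
proof (induction Js)
  case Nil
  then show ?case
    using ideal_prod_commute[OF oneideal foldr_ideal_prod_ideal[of Ks]]
    by (simp add: ideal_prod_one foldr_ideal_prod_ideal)
next
  case (Cons J Js)
  then show ?case by (simp add: ideal_prod_assoc foldr_ideal_prod_ideal)
qed

text \<open>Polarization: the triple (a, a, a) puts all squares into \<open>J\<close>, and the
  triple (a, b, a + b) puts one of ab, a(a + b), b(a + b) there; in each case ab follows by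
  subtracting a square.\<close>

lemma (in cring) TA_ideal_square_subset:
  assumes J: "TA_ideal J R" and M: "ideal M R" and sub: "M \<cdot> (M \<cdot> M) \<subseteq> J"
  shows "M \<cdot> M \<subseteq> J"
proof -
  interpret M: ideal M R by fact
  interpret J: ideal J R using J by (simp add: TA_ideal_def)
  have ta: "a \<otimes> b \<in> J \<or> a \<otimes> c \<in> J \<or> b \<otimes> c \<in> J" if "a \<in> M" "b \<in> M" "c \<in> M" for a b c
  proof -
    have "a \<otimes> (b \<otimes> c) \<in> J" using sub ideal_prod.prod that by (metis subsetD)
    then have "a \<otimes> b \<otimes> c \<in> J" using that M.Icarr by (simp add: m_assoc)
    then show ?thesis using J that M.Icarr unfolding TA_ideal_def by blast
  qed
  have "a \<otimes> b \<in> J" if a: "a \<in> M" and b: "b \<in> M" for a b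
  proof -
    have c: "a \<in> carrier R" "b \<in> carrier R" using a b M.Icarr by auto
    have sq: "a \<otimes> a \<in> J" "b \<otimes> b \<in> J" using ta[OF a a a] ta[OF b b b] by auto
    have e1: "a \<otimes> b = a \<otimes> (a \<oplus> b) \<ominus> a \<otimes> a" using c by algebra
    have e2: "a \<otimes> b = b \<otimes> (a \<oplus> b) \<ominus> b \<otimes> b" using c by algebra
    show ?thesis
      using ta[OF a b, of "a \<oplus> b"] a b e1 e2 sq ideal_minus_closed[OF J.is_ideal] M.a_closed by metis
  qed
  then show ?thesis by (rule ideal_prod_subset[OF J.is_ideal])
qed

text \<open>For \<open>x \<in> M - M\<^sup>2\<close> the ideal \<open>xR + M\<^sup>3\<close> is not contained in \<open>M\<^sup>2\<close>, so its TA-factorization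
  has a single factor. Hence it contains \<open>M\<^sup>2\<close>, and Nakayama's lemma removes \<open>M\<^sup>3\<close>.\<close>

lemma TAF_domain_imp_locally_pseudo_valuation:
  fixes R (structure)
  assumes "noetherian_domain R" "TAF_domain R"
  shows "locally_pseudo_valuation R"
  unfolding locally_pseudo_valuation_def
proof (intro allI impI ballI)
  fix M x
  assume M: "maximalideal M R" "M \<noteq> {\<zero>}" and x: "x \<in> M - M \<cdot> M"
  interpret noetherian_domain R by fact
  interpret T: TAF_domain R by fact
  interpret M: maximalideal M R by fact
  have pM: "primeideal M R" by (rule maximalideal_prime[OF M(1)])
  have MM: "ideal (M \<cdot> M) R" and M3: "ideal (M \<cdot> (M \<cdot> M)) R"
    by (intro ideal_prod_is_ideal M.is_ideal)+
  have xc: "x \<in> carrier R" using x M.Icarr by auto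
  let ?I = "PIdl x <+>\<^bsub>R\<^esub> M \<cdot> (M \<cdot> M)"
  have I: "ideal ?I R" by (intro add_ideals cgenideal_ideal xc M3)
  have sub: "PIdl x \<subseteq> ?I" "M \<cdot> (M \<cdot> M) \<subseteq> ?I"
    by (rule ideal_sum_upper[OF cgenideal_ideal[OF xc] M3])+
  have xI: "x \<in> ?I" using sub cgenideal_self[OF xc] by auto
  have "?I \<subseteq> M"
    using ideal_sum_least[OF M.is_ideal cgenideal_minimal[OF M.is_ideal]] x ideal_prod_inter[OF M.is_ideal MM] by auto
  then have "?I \<noteq> carrier R" using M.I_notcarr M.a_subset by auto
  then obtain Js where Js: "TA_factorization R ?I Js"
    using T.exists_TA_factorization[OF I] by auto
  have J: "TA_ideal J R" "ideal J R" "?I \<subseteq> J" "J \<subseteq> M" if "J \<in> set Js" for J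
  proof -
    show ta: "TA_ideal J R" using Js that by (simp add: TA_factorization_def)
    show id: "ideal J R" using ta by (simp add: TA_ideal_def)
    have "\<And>J. J \<in> set Js \<Longrightarrow> ideal J R" using Js by (simp add: TA_factorization_def TA_ideal_def)
    then show IJ: "?I \<subseteq> J" using Js that foldr_ideal_prod_subset[of Js] by (simp add: TA_factorization_def)
    have "J \<noteq> carrier R" using Js that by (simp add: TA_factorization_def)
    \<comment> \<open>A maximal ideal above a factor contains M^3, hence is \<open>M\<close>. So
      every factor lies in \<open>M\<close>, and two factors would push \<open>?I\<close> into
      M^2.\<close>
    then obtain N where N: "maximalideal N R" "J \<subseteq> N"
      using exists_maximalideal id by blast
    interpret N: maximalideal N R by fact
    have "ideal_pow R M 3 \<subseteq> N"
      using sub(2) IJ N(2) by (simp add: numeral_3_eq_3 ideal_prod_one M.is_ideal)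
    then have "M \<subseteq> N"
      using ideal_pow_subset_prime[OF maximalideal_prime[OF N(1)] M.is_ideal] by blast
    then have "N = M" using M.I_maximal[OF N.is_ideal] N.I_notcarr N.a_subset by auto
    then show "J \<subseteq> M" using N by simp
  qed
  have "Js \<noteq> []" "?I = foldr (ideal_prod R) Js (carrier R)"
    using Js by (auto simp: TA_factorization_def)
  then obtain J Ks where JK: "Js = J # Ks" "?I = J \<cdot> foldr (ideal_prod R) Ks (carrier R)"
    by (cases Js) auto
  have Ks: "Ks = []"
  proof (rule ccontr)
    assume "Ks \<noteq> []"
    then obtain K where K: "K \<in> set Ks" by (cases Ks) auto
    have "foldr (ideal_prod R) Ks (carrier R) \<subseteq> M"
      using foldr_ideal_prod_subset[of Ks K] J JK(1) K by fastforce
    then have "?I \<subseteq> M \<cdot> M"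
      unfolding JK(2) using J JK(1) by (intro ideal_prod_mono) auto
    then show False using x xI by auto
  qed
  have "?I = J" using JK Ks J(2) by (simp add: ideal_prod_one)
  then have "M \<cdot> M \<subseteq> ?I"
    using TA_ideal_square_subset[OF J(1) M.is_ideal] sub JK(1) by auto
  then show "M \<cdot> M \<subseteq> saturation R M (PIdl x)"
    by (intro nakayama[OF pM MM cgenideal_ideal[OF xc]])
qed

section \<open>Local division by a uniformizer\<close>

context noetherian_domain
begin

text \<open>The local condition yields only a cofactor \<open>q\<close> in the ring. If
  \<open>q\<close> were outside \<open>M\<close>, it could be cancelled from q x in M^2, giving x in
  M^2. Thus M^2 = x M locally.\<close>

lemma square_cofactor:
  assumes lpv: "locally_pseudo_valuation R"
    and M: "maximalideal M R" "M \<noteq> {\<zero>}" and x: "x \<in> M - M \<cdot> M" and p: "p \<in> M \<cdot> M"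
  obtains s q where "s \<in> carrier R - M" "q \<in> M" "s \<otimes> p = x \<otimes> q"
proof -
  interpret M: maximalideal M R by fact
  have MM: "ideal (M \<cdot> M) R" by (intro ideal_prod_is_ideal M.is_ideal)
  have xc: "x \<in> carrier R" using x M.Icarr by auto
  have "p \<in> saturation R M (PIdl x)" using lpv M x p unfolding locally_pseudo_valuation_def by blast
  then obtain s q where sq: "p \<in> carrier R" "s \<in> carrier R - M" "q \<in> carrier R" "s \<otimes> p = q \<otimes> x"
    unfolding saturation_def cgenideal_def by auto
  have "q \<in> M"
  proof (rule ccontr)
    assume q: "q \<notin> M"
    have "q \<otimes> x \<in> M \<cdot> M" using sq p ideal.I_l_closed[OF MM p, of s] by simp
    then have "x \<in> M \<cdot> M"
      using mem_of_mult_mem[OF M(1) sq(3) q MM, of 2 x] xc by (simp add: ideal_pow_two M.is_ideal)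
    then show False using x by simp
  qed
  then show ?thesis using that sq xc by (simp add: m_comm)
qed

text \<open>This replaces induction on the discrete valuation: \<open>q\<close> is \<open>p\<close>
  divided by \<open>x\<close> up to a local unit, and the saturations of the principal ideals grow
  strictly, so the process stops. Elements of M - M^2 are uniformizers of the valuation ring, though
  not necessarily generators of \<open>M\<close>.\<close>

lemma nonzero_induct [consumes 6, case_names unit uniformizer step]:
  assumes lpv: "locally_pseudo_valuation R"
    and M: "maximalideal M R" "M \<noteq> {\<zero>}" and x: "x \<in> M - M \<cdot> M"
    and p: "p \<in> carrier R" "p \<noteq> \<zero>"
    and unit: "\<And>p. p \<in> carrier R - M \<Longrightarrow> P p"
    and uniformizer: "\<And>p. p \<in> M - M \<cdot> M \<Longrightarrow> P p"
    and step: "\<And>p q s. p \<in> M \<cdot> M \<Longrightarrow> p \<noteq> \<zero> \<Longrightarrow> s \<in> carrier R - M \<Longrightarrow> q \<in> M \<Longrightarrow> q \<noteq> \<zero> \<Longrightarrow>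
       s \<otimes> p = x \<otimes> q \<Longrightarrow> P q \<Longrightarrow> P p"
  shows "P p"
proof -
  interpret M: primeideal M R by (rule maximalideal_prime[OF M(1)])
  have MM: "ideal (M \<cdot> M) R" by (intro ideal_prod_is_ideal M.is_ideal)
  have sat: "ideal (saturation R M (PIdl p)) R" if "p \<in> carrier R" for p
    by (intro M.saturation_ideal cgenideal_ideal that)
  have "\<forall>p\<in>carrier R. p \<noteq> \<zero> \<longrightarrow> U = saturation R M (PIdl p) \<longrightarrow> P p" if "ideal U R" for U
    using that
  proof (induction U rule: noetherian_induct)
    case (step U)
    show ?case
    proof (intro ballI impI)
      fix p assume p: "p \<in> carrier R" "p \<noteq> \<zero>" "U = saturation R M (PIdl p)"
      consider "p \<in> carrier R - M" | "p \<in> M - M \<cdot> M" | "p \<in> M \<cdot> M" using p by auto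
      then show "P p"
      proof cases
        case 3
        obtain s q where sq: "s \<in> carrier R - M" "q \<in> M" "s \<otimes> p = x \<otimes> q"
          using square_cofactor[OF lpv M x 3] .
        have c: "q \<in> carrier R" "x \<in> carrier R" using sq x M.Icarr by auto
        have "s \<noteq> \<zero>" using sq(1) M.zero_closed by auto
        then have q0: "q \<noteq> \<zero>" using sq p c integral[of s p] by auto
        have "s \<otimes> p \<in> PIdl q" using sq c by (auto simp: cgenideal_def)
        then have "p \<in> saturation R M (PIdl q)" using M.saturation_memI p sq by auto
        then have "PIdl p \<subseteq> saturation R M (PIdl q)" by (rule cgenideal_minimal[OF sat[OF c(1)]])
        then have sub: "U \<subseteq> saturation R M (PIdl q)"
          unfolding p(3) using M.saturation_mult_memD by (meson M.saturation_memE subsetD subsetI)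
        \<comment> \<open>Otherwise \<open>q\<close> would locally be a multiple of
          \<open>p\<close>, hence of x q; cancelling \<open>q\<close> would make a product of
          elements outside \<open>M\<close> a multiple of \<open>x\<close>.\<close>
        have "q \<notin> U"
        proof
          assume "q \<in> U"
          then obtain t r where t: "t \<in> carrier R - M" "r \<in> carrier R" "t \<otimes> q = r \<otimes> p"
            unfolding p(3) saturation_def cgenideal_def by auto
          have "(s \<otimes> t) \<otimes> q = s \<otimes> (t \<otimes> q)" using sq t c by (simp add: m_assoc)
          also have "\<dots> = r \<otimes> (s \<otimes> p)" using t sq p by (simp add: m_lcomm)
          also have "\<dots> = (r \<otimes> x) \<otimes> q" using sq t c by (simp add: m_assoc)
          finally have "s \<otimes> t = r \<otimes> x" using m_rcancel[OF q0 c(1)] sq t c by auto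
          moreover have "r \<otimes> x \<in> M" using M.I_l_closed x t by auto
          ultimately show False using M.mult_notin[OF sq(1) t(1)] by auto
        qed
        moreover have "q \<in> saturation R M (PIdl q)"
          using M.saturation_increasing[of "PIdl q"] cgenideal_self[OF c(1)]
            additive_subgroup.a_subset[OF ideal.axioms(1)[OF cgenideal_ideal[OF c(1)]]] by auto
        ultimately have "U \<subset> saturation R M (PIdl q)" using sub by auto
        then have "P q" using step.IH[OF sat[OF c(1)]] c q0 by auto
        then show ?thesis using assms(9)[OF 3 p(2) sq(1,2) q0 sq(3)] by auto
      qed (use unit uniformizer in auto)
    qed
  qed
  then show ?thesis using sat p by auto
qed

text \<open>Induction by division: if M^n lies locally in qR, then M^2 M^n lies locally in x qR,
  which is locally pR. This bound yields dimension at most one and the exponents of the primary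
  factors.\<close>

lemma pow_subset_saturation:
  assumes lpv: "locally_pseudo_valuation R"
    and M: "maximalideal M R" "M \<noteq> {\<zero>}" and p: "p \<in> carrier R" "p \<noteq> \<zero>"
  shows "\<exists>n. ideal_pow R M n \<subseteq> saturation R M (PIdl p)"
proof -
  interpret M: primeideal M R by (rule maximalideal_prime[OF M(1)])
  obtain x where x: "x \<in> M - M \<cdot> M" using prime_square_proper[OF M.primeideal M(2)] .
  have xc: "x \<in> carrier R" using x M.Icarr by auto
  from lpv M x p show ?thesis
  proof (induction rule: nonzero_induct)
    case (unit p)
    have "ideal_pow R M 0 \<subseteq> saturation R M (PIdl p)"
      using unit by (auto simp: saturation_def cgenideal_def intro!: bexI[of _ p] m_comm)
    then show ?case by blast
  next
    case (uniformizer p)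
    have "ideal_pow R M 2 \<subseteq> saturation R M (PIdl p)"
      using lpv M uniformizer unfolding locally_pseudo_valuation_def ideal_pow_two[OF M.is_ideal] by blast
    then show ?case by blast
  next
    case (step p q s)
    then obtain n where n: "ideal_pow R M n \<subseteq> saturation R M (PIdl q)" by auto
    have pc: "p \<in> carrier R" using step(1) ideal_prod_in_carrier[OF M.is_ideal M.is_ideal] by auto
    have qc: "q \<in> carrier R" using step M.Icarr by auto
    have "t \<otimes> u \<in> saturation R M (PIdl p)" if t: "t \<in> M \<cdot> M" and u: "u \<in> ideal_pow R M n" for t u
    proof -
      have tc: "t \<in> carrier R" using t ideal_prod_in_carrier[OF M.is_ideal M.is_ideal] by auto
      obtain s1 r1 where 1: "s1 \<in> carrier R - M" "r1 \<in> M" "s1 \<otimes> t = x \<otimes> r1"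
        using square_cofactor[OF lpv M x t] .
      obtain s2 r2 where 2: "u \<in> carrier R" "s2 \<in> carrier R - M" "r2 \<in> carrier R" "s2 \<otimes> u = r2 \<otimes> q"
        using n u unfolding saturation_def cgenideal_def by blast
      have r1c: "r1 \<in> carrier R" using 1 M.Icarr by auto
      have "(s1 \<otimes> s2) \<otimes> (t \<otimes> u) = (s1 \<otimes> t) \<otimes> (s2 \<otimes> u)" using 1(1) 2(1,2) tc by (simp add: m_ac)
      also have "\<dots> = (r1 \<otimes> r2) \<otimes> (x \<otimes> q)" unfolding 1 2 using r1c 2 xc qc by (simp add: m_ac)
      also have "\<dots> = (r1 \<otimes> r2 \<otimes> s) \<otimes> p" unfolding step(6)[symmetric] using r1c 2 step(3) pc by (simp add: m_assoc)
      finally have "(s1 \<otimes> s2) \<otimes> (t \<otimes> u) \<in> PIdl p"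
        using r1c 2 step by (auto simp: cgenideal_def)
      then show ?thesis
        using M.saturation_memI[OF _ M.mult_notin[OF 1(1) 2(2)]] tc 2(1) by auto
    qed
    \<comment> \<open>The exponent grows by two because the local condition puts M^2, not
      \<open>M\<close>, into xR.\<close>
    then have "ideal_pow R M (2 + n) \<subseteq> saturation R M (PIdl p)"
      unfolding ideal_pow_add[OF M.is_ideal] ideal_pow_two[OF M.is_ideal]
      by (intro ideal_prod_subset M.saturation_ideal cgenideal_ideal pc)
    then show ?case by blast
  qed
qed

text \<open>For a nonzero p in \<open>P\<close> and a maximal ideal \<open>M\<close> above
  \<open>P\<close>, the saturation of pR at \<open>M\<close> stays inside the prime
  \<open>P\<close>, yet contains a power of \<open>M\<close>.\<close>

lemma nonzero_prime_maximal:
  assumes lpv: "locally_pseudo_valuation R" and P: "primeideal P R" "P \<noteq> {\<zero>}"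
  shows "maximalideal P R"
proof -
  interpret P: primeideal P R by fact
  obtain M where M: "maximalideal M R" "P \<subseteq> M"
    using exists_maximalideal[OF P.is_ideal] P.I_notcarr by metis
  interpret M: maximalideal M R by fact
  obtain p where p: "p \<in> P" "p \<noteq> \<zero>" using P P.zero_closed by auto
  then obtain n where n: "ideal_pow R M n \<subseteq> saturation R M (PIdl p)"
    using pow_subset_saturation[OF lpv M(1), of p] M(2) P.Icarr by auto
  have "saturation R M (PIdl p) \<subseteq> P"
    using cgenideal_minimal[OF P.is_ideal p(1)] P.I_prime M(2) unfolding saturation_def by blast
  then have "M \<subseteq> P" using n ideal_pow_subset_prime[OF P(1) M.is_ideal] by blast
  then show ?thesis using M by (metis subset_antisym)
qed

end

section \<open>TA-factorizations in locally pseudo-valuation domains\<close>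

lemma TA_factorization_ideals:
  "TA_factorization R I Js \<Longrightarrow> J \<in> set Js \<Longrightarrow> ideal J R"
  by (simp add: TA_factorization_def TA_ideal_def)

lemma (in ring) TA_factorization_single:
  assumes "TA_ideal J R" "J \<noteq> carrier R"
  shows "TA_factorization R J [J]"
  using assms by (simp add: TA_factorization_def TA_ideal_def ideal_prod_one)

lemma (in cring) TA_factorization_append:
  assumes "TA_factorization R I Js" "TA_factorization R J Ks"
  shows "TA_factorization R (I \<cdot> J) (Js @ Ks)"
proof -
  have "foldr (ideal_prod R) (Js @ Ks) (carrier R) =
     foldr (ideal_prod R) Js (carrier R) \<cdot> foldr (ideal_prod R) Ks (carrier R)"
    using assms by (intro foldr_ideal_prod_append TA_factorization_ideals)
  then show ?thesis using assms by (auto simp: TA_factorization_def)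
qed

lemma (in cring) prime_TA_ideal: "primeideal P R \<Longrightarrow> TA_ideal P R"
  unfolding TA_ideal_def
  by (metis ideal.I_r_closed m_closed m_comm primeideal.I_prime primeideal.axioms(1) m_assoc)

text \<open>Among \<open>a\<close>, \<open>b\<close>, \<open>c\<close> either two lie in
  \<open>M\<close>, and their product is in M^2, or two lie outside \<open>M\<close> and can be
  cancelled together, which leaves the third in \<open>J\<close>.\<close>

lemma (in cring) TA_ideal_of_square_subset:
  assumes M: "maximalideal M R" and J: "ideal J R" "M \<cdot> M \<subseteq> J" "J \<subseteq> M"
  shows "TA_ideal J R"
  unfolding TA_ideal_def
proof (intro conjI ballI impI)
  interpret M: primeideal M R by (rule maximalideal_prime[OF M])
  fix a b c assume c: "a \<in> carrier R" "b \<in> carrier R" "c \<in> carrier R" and abc: "a \<otimes> b \<otimes> c \<in> J"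
  have both: "u \<otimes> v \<in> J" if "u \<in> M" "v \<in> M" for u v
    using J(2) ideal_prod.prod[OF that, of R] by auto
  have cancel: "d \<in> J" if "u \<in> carrier R - M" "v \<in> carrier R - M" "d \<in> carrier R" "(u \<otimes> v) \<otimes> d \<in> J" for u v d
    using mem_of_mult_mem[OF M _ _ J(1), of "u \<otimes> v" 2 d] M.mult_notin[OF that(1,2)] J(2) that(3,4)
    by (simp add: ideal_pow_two M.is_ideal)
  have absorb: "a \<in> J \<Longrightarrow> a \<otimes> b \<in> J" "b \<in> J \<Longrightarrow> a \<otimes> b \<in> J" "c \<in> J \<Longrightarrow> a \<otimes> c \<in> J"
    using c ideal.I_r_closed[OF J(1)] ideal.I_l_closed[OF J(1)] by auto
  have perm: "(b \<otimes> c) \<otimes> a \<in> J" "(a \<otimes> c) \<otimes> b \<in> J" "(a \<otimes> b) \<otimes> c \<in> J"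
    using abc c by (simp_all add: m_ac)
  show "a \<otimes> b \<in> J \<or> a \<otimes> c \<in> J \<or> b \<otimes> c \<in> J"
    using both[of a b] both[of a c] both[of b c] cancel[of b c a] cancel[of a c b] cancel[of a b c]
      absorb perm c by blast
qed (rule J(1))

section \<open>Factoring ideals\<close>

context noetherian_domain
begin

text \<open>Locally xR + M^2 is just xR, so splitting it off is division by \<open>x\<close>, and
  the cofactor is Q : x. Both sides of the product formula contain a power of \<open>M\<close>, so
  the local equality is an equality. The exponent drops from \<open>Suc k\<close> to
  \<open>k\<close>.\<close>

lemma factor_uniformizer:
  assumes lpv: "locally_pseudo_valuation R" and M: "maximalideal M R" "M \<noteq> {\<zero>}"
    and x: "x \<in> M - M \<cdot> M"
    and Q: "ideal Q R" "ideal_pow R M (Suc k) \<subseteq> Q" "Q \<subseteq> M \<cdot> M"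
  defines "Q' \<equiv> {d \<in> carrier R. \<forall>a\<in>{x}. a \<otimes> d \<in> Q}"
  shows "ideal_pow R M k \<subseteq> Q'" "Q' \<subseteq> M" "Q = (PIdl x <+>\<^bsub>R\<^esub> M \<cdot> M) \<cdot> Q'"
proof -
  interpret M: maximalideal M R by fact
  interpret Q: ideal Q R by fact
  have xc: "x \<in> carrier R" and xM: "x \<in> M" using x M.Icarr by auto
  let ?L = "PIdl x <+>\<^bsub>R\<^esub> M \<cdot> M"
  have MM: "ideal (M \<cdot> M) R" by (intro ideal_prod_is_ideal M.is_ideal)
  have L: "ideal ?L R" by (intro add_ideals cgenideal_ideal xc MM)
  have Q': "ideal Q' R" unfolding Q'_def using Q(1) xc by (intro colon_ideal) auto
  have Q'D: "d \<in> carrier R" "x \<otimes> d \<in> Q" if "d \<in> Q'" for d using that by (auto simp: Q'_def)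
  have LQ: "ideal (?L \<cdot> Q') R" by (intro ideal_prod_is_ideal L Q')
  have Lsub: "PIdl x \<subseteq> ?L" "M \<cdot> M \<subseteq> ?L" by (rule ideal_sum_upper[OF cgenideal_ideal[OF xc] MM])+
  then have xL: "x \<in> ?L" using cgenideal_self[OF xc] by auto
  show pow: "ideal_pow R M k \<subseteq> Q'"
  proof
    fix d assume d: "d \<in> ideal_pow R M k"
    have "x \<otimes> d \<in> Q" using Q(2) ideal_prod.prod[OF xM d, of R] by auto
    then show "d \<in> Q'" using d ideal.Icarr[OF ideal_pow_ideal[OF M.is_ideal]] by (auto simp: Q'_def)
  qed
  show "Q' \<subseteq> M"
  proof
    fix d assume d: "d \<in> Q'"
    show "d \<in> M"
    proof (rule ccontr)
      assume "d \<notin> M"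
      moreover have "d \<otimes> x \<in> M \<cdot> M" using Q'D[OF d] Q(3) xc by (auto simp: m_comm)
      ultimately have "x \<in> M \<cdot> M"
        using mem_of_mult_mem[OF M(1) Q'D(1)[OF d] _ MM, of 2 x] xc by (simp add: ideal_pow_two M.is_ideal)
      then show False using x by simp
    qed
  qed
  show "Q = ?L \<cdot> Q'"
  proof
    have "i \<otimes> d \<in> Q" if i: "i \<in> ?L" and d: "d \<in> Q'" for i d
    proof -
      obtain u t where "u \<in> PIdl x" and t: "t \<in> M \<cdot> M" "i = u \<oplus> t"
        using i unfolding ideal_sum_iff by blast
      then obtain r where r: "r \<in> carrier R" "u = r \<otimes> x" unfolding cgenideal_def by blast
      obtain s q where sq: "s \<in> carrier R - M" "q \<in> M" "s \<otimes> t = x \<otimes> q"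
        using square_cofactor[OF lpv M x t(1)] .
      have tc: "t \<in> carrier R" and qc: "q \<in> carrier R" and dc: "d \<in> carrier R"
        using t ideal.Icarr[OF MM] sq M.Icarr Q'D[OF d] by auto
      have "s \<otimes> (t \<otimes> d) = (s \<otimes> t) \<otimes> d" using sq(1) tc dc by (simp add: m_assoc)
      also have "\<dots> = q \<otimes> (x \<otimes> d)" unfolding sq(3) using xc qc dc by (simp add: m_ac)
      also have "\<dots> \<in> Q" using Q.I_l_closed Q'D[OF d] qc by blast
      finally have "t \<otimes> d \<in> Q"
        using mem_of_mult_mem[OF M(1) _ _ Q(1,2), of s "t \<otimes> d"] sq(1) tc dc by auto
      moreover have "u \<otimes> d = r \<otimes> (x \<otimes> d)" using r xc dc by (simp add: m_assoc)
      then have "u \<otimes> d \<in> Q" using Q.I_l_closed Q'D[OF d] r by auto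
      moreover have "i \<otimes> d = u \<otimes> d \<oplus> t \<otimes> d" using t r xc tc dc by (simp add: l_distr)
      ultimately show ?thesis by auto
    qed
    then show "?L \<cdot> Q' \<subseteq> Q" by (rule ideal_prod_subset[OF Q(1)])
    \<comment> \<open>A power of \<open>M\<close> inside the product is what permits cancelling
      elements outside \<open>M\<close> there.\<close>
    have "ideal_pow R M (2 + k) \<subseteq> ?L \<cdot> Q'"
      unfolding ideal_pow_add[OF M.is_ideal] ideal_pow_two[OF M.is_ideal]
      by (rule ideal_prod_mono[OF Lsub(2) pow])
    note cancel = mem_of_mult_mem[OF M(1) _ _ LQ this]
    show "Q \<subseteq> ?L \<cdot> Q'"
    proof
      fix q assume q: "q \<in> Q"
      then obtain s m where sm: "s \<in> carrier R - M" "m \<in> M" "s \<otimes> q = x \<otimes> m"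
        using square_cofactor[OF lpv M x] Q(3) by blast
      have "x \<otimes> m \<in> Q" using sm q Q.I_l_closed by (metis DiffD1)
      then have "m \<in> Q'" using sm M.Icarr by (auto simp: Q'_def)
      then have "s \<otimes> q \<in> ?L \<cdot> Q'" unfolding sm(3) by (rule ideal_prod.prod[OF xL])
      then show "q \<in> ?L \<cdot> Q'" using cancel sm q Q.Icarr by blast
    qed
  qed
qed

lemma exists_TA_factorization_primary:
  assumes lpv: "locally_pseudo_valuation R" and M: "maximalideal M R" "M \<noteq> {\<zero>}"
    and Q: "ideal Q R" "ideal_pow R M k \<subseteq> Q" "Q \<subseteq> M"
  shows "\<exists>Js. TA_factorization R Q Js"
  using Q
proof (induction k arbitrary: Q)
  \<comment> \<open>The zeroth power is the whole ring, so it would lie in \<open>Q\<close> and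
    hence in \<open>M\<close>.\<close>
  case 0
  then show ?case
    using maximalideal.I_notcarr[OF M(1)] additive_subgroup.a_subset[OF ideal.axioms(1)[OF maximalideal.axioms(1)[OF M(1)]]]
    by (metis ideal_pow.simps(1) subset_antisym subset_trans)
next
  case (Suc k)
  interpret M: primeideal M R by (rule maximalideal_prime[OF M(1)])
  have MM: "ideal (M \<cdot> M) R" by (intro ideal_prod_is_ideal M.is_ideal)
  have TA: "\<exists>Js. TA_factorization R J Js" if "ideal J R" "M \<cdot> M \<subseteq> J" "J \<subseteq> M" for J
  proof -
    have "J \<noteq> carrier R" using that(3) M.I_notcarr M.a_subset by auto
    then show ?thesis
      using TA_factorization_single[OF TA_ideal_of_square_subset[OF M(1) that]] by blast
  qed
  show ?case
  proof (cases "Q \<subseteq> M \<cdot> M")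
    case True
    obtain x where x: "x \<in> M - M \<cdot> M" using prime_square_proper[OF M.primeideal M(2)] .
    have xc: "x \<in> carrier R" using x M.Icarr by auto
    let ?Q = "{d \<in> carrier R. \<forall>a\<in>{x}. a \<otimes> d \<in> Q}"
    let ?L = "PIdl x <+>\<^bsub>R\<^esub> M \<cdot> M"
    note f = factor_uniformizer[OF lpv M x Suc.prems(1,2) True]
    have "ideal ?Q R" using Suc.prems xc by (intro colon_ideal) auto
    then obtain Ks where Ks: "TA_factorization R ?Q Ks" using Suc.IH f by blast
    have "ideal ?L R" by (intro add_ideals cgenideal_ideal xc MM)
    moreover have "M \<cdot> M \<subseteq> ?L" by (rule ideal_sum_upper[OF cgenideal_ideal[OF xc] MM])
    moreover have "?L \<subseteq> M"
      using ideal_sum_least[OF M.is_ideal cgenideal_minimal[OF M.is_ideal]] x ideal_prod_inter[OF M.is_ideal M.is_ideal]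
      by auto
    ultimately obtain Js where Js: "TA_factorization R ?L Js" using TA by blast
    have "TA_factorization R Q (Js @ Ks)"
      by (subst f(3)) (rule TA_factorization_append[OF Js Ks])
    then show ?thesis by blast
  next
    case False
    then obtain x where x: "x \<in> Q" "x \<in> M - M \<cdot> M" using Suc.prems by auto
    have "M \<cdot> M \<subseteq> Q"
    proof
      fix p assume p: "p \<in> M \<cdot> M"
      obtain s q where sq: "s \<in> carrier R - M" "q \<in> M" "s \<otimes> p = x \<otimes> q"
        using square_cofactor[OF lpv M x(2) p] .
      then have "s \<otimes> p \<in> Q" using ideal.I_r_closed[OF Suc.prems(1) x(1)] M.Icarr by auto
      then show "p \<in> Q"
        using mem_of_mult_mem[OF M(1) _ _ Suc.prems(1,2), of s p] sq(1) p ideal.Icarr[OF MM] by auto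
    qed
    then show ?thesis using TA Suc.prems by blast
  qed
qed

text \<open>The quotients B : s with \<open>s\<close> outside \<open>M\<close> have a maximal
  member. Since B : s is contained in B : (s t), that member already absorbs every other denominator
  \<open>t\<close>.\<close>

lemma saturation_uniform:
  assumes M: "primeideal M R" and B: "ideal B R"
  shows "\<exists>s\<in>carrier R - M. \<forall>d\<in>saturation R M B. s \<otimes> d \<in> B"
proof -
  interpret M: primeideal M R by fact
  interpret B: ideal B R by fact
  define C where "C s = {d \<in> carrier R. \<forall>a\<in>{s}. a \<otimes> d \<in> B}" for s
  have id: "ideal (C s) R" if "s \<in> carrier R" for s
    unfolding C_def using that by (intro colon_ideal B) auto
  have one: "\<one> \<in> carrier R - M" using M.one_notin by simp
  obtain U where U: "\<exists>s\<in>carrier R - M. U = C s"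
    and max: "\<And>J. ideal J R \<Longrightarrow> \<exists>s\<in>carrier R - M. J = C s \<Longrightarrow> U \<subseteq> J \<Longrightarrow> J = U"
    by (rule exists_maximal_ideal_with[OF id[OF one_closed], of "\<lambda>J. \<exists>s\<in>carrier R - M. J = C s"])
      (use one in blast)+
  then obtain s where s: "s \<in> carrier R - M" "U = C s" by blast
  have "s \<otimes> d \<in> B" if "d \<in> saturation R M B" for d
  proof -
    obtain t where t: "d \<in> carrier R" "t \<in> carrier R - M" "t \<otimes> d \<in> B"
      using \<open>d \<in> saturation R M B\<close> by (rule M.saturation_memE)
    have st: "s \<otimes> t \<in> carrier R - M" by (rule M.mult_notin[OF s(1) t(2)])
    have "C s \<subseteq> C (s \<otimes> t)"
    proof
      fix e assume e: "e \<in> C s"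
      have "s \<otimes> t \<otimes> e = t \<otimes> (s \<otimes> e)" using e s(1) t(2) by (simp add: C_def m_ac)
      then show "e \<in> C (s \<otimes> t)" using e t(2) B.I_l_closed by (auto simp: C_def)
    qed
    then have "C (s \<otimes> t) = C s" using max[OF id] st s by blast
    moreover have "d \<in> C (s \<otimes> t)"
      using t s B.I_l_closed[OF t(3), of s] by (auto simp: C_def m_assoc)
    ultimately show ?thesis by (simp add: C_def)
  qed
  then show ?thesis using s by blast
qed

text \<open>The comaximal factors are \<open>I + M\<^sup>n\<close> and \<open>I : M\<^sup>n\<close> for large \<open>n\<close>.\<close>

lemma split_off_primary:
  assumes lpv: "locally_pseudo_valuation R" and M: "maximalideal M R"
    and I: "ideal I R" "I \<noteq> {\<zero>}" "I \<subseteq> M"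
  obtains n I' where "ideal I' R" "I \<subset> I'" "ideal_pow R M (Suc n) \<subseteq> M"
    "I = (I <+>\<^bsub>R\<^esub> ideal_pow R M (Suc n)) \<cdot> I'"
proof -
  interpret M: primeideal M R by (rule maximalideal_prime[OF M])
  interpret I: ideal I R by fact
  obtain p where p: "p \<in> I" "p \<noteq> \<zero>" using I I.zero_closed by auto
  have "M \<noteq> {\<zero>}" using p I by auto
  then obtain n where n: "ideal_pow R M n \<subseteq> saturation R M (PIdl p)"
    using pow_subset_saturation[OF lpv M] p I.Icarr by blast
  \<comment> \<open>The successor keeps \<open>?N\<close> inside \<open>M\<close> even when
    \<open>n\<close> is zero.\<close>
  let ?N = "ideal_pow R M (Suc n)"
  have N: "ideal ?N R" by (rule ideal_pow_ideal[OF M.is_ideal])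
  interpret N: ideal ?N R by fact
  have "?N \<subseteq> saturation R M I"
    using ideal_pow_antimono[OF M.is_ideal, of n "Suc n"] n
      M.saturation_mono[OF cgenideal_minimal[OF I(1) p(1)]] by auto
  \<comment> \<open>A single \<open>s\<close> outside \<open>M\<close> carries all of
    \<open>?N\<close> into \<open>I\<close>, so it lies in \<open>?C\<close>. This makes
    \<open>?C\<close> strictly larger than \<open>I\<close>, and comaximal with \<open>?Q\<close>
    since \<open>s\<close> is a unit modulo \<open>?N\<close>.\<close>
  then obtain s where s: "s \<in> carrier R - M" "\<forall>d\<in>?N. s \<otimes> d \<in> I"
    using saturation_uniform[OF M.primeideal I(1)] by blast
  let ?C = "{d \<in> carrier R. \<forall>a\<in>?N. a \<otimes> d \<in> I}"
  have C: "ideal ?C R" by (rule colon_ideal[OF I(1) N.a_subset])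
  have sC: "s \<in> ?C" using s N.Icarr by (auto simp: m_comm)
  have IC: "I \<subseteq> ?C" using I.I_l_closed I.Icarr N.Icarr by auto
  let ?Q = "I <+>\<^bsub>R\<^esub> ?N"
  have Q: "ideal ?Q R" by (rule add_ideals[OF I(1) N])
  have Qsub: "I \<subseteq> ?Q" "?N \<subseteq> ?Q" by (rule ideal_sum_upper[OF I(1) N])+
  have "\<one> \<in> ?Q <+>\<^bsub>R\<^esub> ?C"
  proof -
    obtain r where r: "r \<in> carrier R" "\<one> \<ominus> r \<otimes> s \<in> ?N"
      using maximalideal_pow_witness[OF M, of s "Suc n"] s by blast
    have "\<one> = (\<one> \<ominus> r \<otimes> s) \<oplus> r \<otimes> s"
      using r(1) s(1) by (metis DiffD1 add.inv_solve_right minus_eq m_closed one_closed a_minus_def minus_closed)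
    moreover have "r \<otimes> s \<in> ?C" by (rule ideal.I_l_closed[OF C sC r(1)])
    ultimately show ?thesis using r(2) Qsub unfolding ideal_sum_iff by blast
  qed
  then have "?Q <+>\<^bsub>R\<^esub> ?C = carrier R" by (rule ideal.one_imp_carrier[OF add_ideals[OF Q C]])
  then have eq: "?Q \<cdot> ?C = ?Q \<inter> ?C" by (rule ideal_prod_eq_inter[OF Q C])
  have "?Q \<cdot> ?C \<subseteq> I"
  proof (rule ideal_prod_subset[OF I(1)])
    fix i d assume i: "i \<in> ?Q" and d: "d \<in> ?C"
    obtain a b where ab: "a \<in> I" "b \<in> ?N" "i = a \<oplus> b" using i unfolding ideal_sum_iff by blast
    have "i \<otimes> d = a \<otimes> d \<oplus> b \<otimes> d" using ab d I.Icarr N.Icarr by (simp add: l_distr)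
    then show "i \<otimes> d \<in> I" using ab d I.I_r_closed by auto
  qed
  then have prod: "I = ?Q \<cdot> ?C" using eq Qsub IC by auto
  have lt: "I \<subset> ?C" using IC sC s I(3) by auto
  have sub: "?N \<subseteq> M"
    using ideal_pow_antimono[OF M.is_ideal, of "Suc 0" "Suc n"] ideal_pow_one[OF M.is_ideal] by force
  show ?thesis by (rule that[OF C lt sub prod])
qed

text \<open>Splitting off a primary factor leaves a strictly larger cofactor, so Noetherian
  induction handles the rest.\<close>

lemma exists_TA_factorization_nonzero:
  assumes lpv: "locally_pseudo_valuation R" and I: "ideal I R" "I \<noteq> {\<zero>}" "I \<noteq> carrier R"
  shows "\<exists>Js. TA_factorization R I Js"
  using I
proof (induction I rule: noetherian_induct)
  case (step I)
  obtain M where M: "maximalideal M R" "I \<subseteq> M"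
    using exists_maximalideal[OF step.hyps step.prems(2)] .
  interpret M: maximalideal M R by fact
  obtain n I' where I': "ideal I' R" "I \<subset> I'" "ideal_pow R M (Suc n) \<subseteq> M"
    "I = (I <+>\<^bsub>R\<^esub> ideal_pow R M (Suc n)) \<cdot> I'"
    using split_off_primary[OF lpv M(1) step.hyps step.prems(1) M(2)] .
  let ?Q = "I <+>\<^bsub>R\<^esub> ideal_pow R M (Suc n)"
  have N: "ideal (ideal_pow R M (Suc n)) R" by (rule ideal_pow_ideal[OF M.is_ideal])
  have Q: "ideal ?Q R" by (rule add_ideals[OF step.hyps N])
  have zero: "\<zero> \<in> I" by (rule additive_subgroup.zero_closed[OF ideal.axioms(1)[OF step.hyps]])
  have "M \<noteq> {\<zero>}" using M(2) step.prems(1) zero by auto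
  then obtain Js where Js: "TA_factorization R ?Q Js"
    using exists_TA_factorization_primary[OF lpv M(1) _ Q ideal_sum_upper(2)[OF step.hyps N]]
      ideal_sum_least[OF M.is_ideal M(2) I'(3)] by blast
  show ?case
  proof (cases "I' = carrier R")
    \<comment> \<open>Here \<open>I\<close> is itself the primary factor; the unit ideal is outside
      the scope of the induction hypothesis.\<close>
    case True
    then have "?Q \<cdot> I' = ?Q" using ideal_prod_one[OF Q] by simp
    with I'(4) have "I = ?Q" by (rule trans)
    show ?thesis by (subst \<open>I = ?Q\<close>) (use Js in blast)
  next
    case False
    have "I' \<noteq> {\<zero>}" using I'(2) zero by auto
    then obtain Ks where Ks: "TA_factorization R I' Ks" using step.IH[OF I'(1,2)] False by auto
    have "TA_factorization R I (Js @ Ks)"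
      by (subst I'(4)) (rule TA_factorization_append[OF Js Ks])
    then show ?thesis by blast
  qed
qed

lemma locally_pseudo_valuation_imp_TAF_domain:
  assumes "locally_pseudo_valuation R"
  shows "TAF_domain R"
proof
  fix I assume I: "ideal I R" "I \<noteq> carrier R"
  show "\<exists>Js. TA_factorization R I Js"
  proof (cases "I = {\<zero>}")
    case True
    then show ?thesis
      using TA_factorization_single[OF prime_TA_ideal[OF zeroprimeideal]] I by auto
  qed (use exists_TA_factorization_nonzero[OF assms] I in blast)
qed

section \<open>Descending chains above a nonzero ideal\<close>

text \<open>If \<open>ab \<in> I\<close>, a chain above \<open>I\<close> is controlled by its sums with \<open>aR\<close> and its quotients by \<open>a\<close>,
  which are chains above strictly larger ideals.\<close>

lemma descending_chain_stable:
  fixes f :: "nat \<Rightarrow> 'a set"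
  assumes max: "\<And>P. primeideal P R \<Longrightarrow> P \<noteq> {\<zero>} \<Longrightarrow> maximalideal P R"
    and I: "ideal I R" "I \<noteq> {\<zero>}"
    and f: "\<And>n. ideal (f n) R" "\<And>n. f (Suc n) \<subseteq> f n" "\<And>n. I \<subseteq> f n"
  shows "\<exists>m. \<forall>n\<ge>m. f n = f m"
  using I f
proof (induction I arbitrary: f rule: noetherian_induct)
  case (step I)
  interpret I: ideal I R by fact
  have zero: "\<zero> \<in> J" if "ideal J R" for J
    by (rule additive_subgroup.zero_closed[OF ideal.axioms(1)[OF that]])
  have dec: "f n \<subseteq> f m" if "m \<le> n" for m n
    using lift_Suc_antimono_le[of f, OF step.prems(3) that] .
  show ?case
  proof (cases "primeideal I R \<or> I = carrier R")
    case True
    have fc: "f n \<subseteq> carrier R" for n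
      by (rule additive_subgroup.a_subset[OF ideal.axioms(1)[OF step.prems(2)]])
    \<comment> \<open>A nonzero prime is maximal by \<open>max\<close>, so nothing lies strictly
      between it and the ring.\<close>
    have dich: "f n = I \<or> f n = carrier R" for n
    proof (cases "I = carrier R")
      case True
      then show ?thesis using step.prems(4)[of n] fc[of n] by simp
    next
      case False
      then have "maximalideal I R" using max[OF _ step.prems(1)] True by simp
      then show ?thesis
        using maximalideal.I_maximal[OF _ step.prems(2) step.prems(4) fc] by simp
    qed
    show ?thesis
    proof (cases "\<exists>m. f m = I")
      case True
      then show ?thesis using dec step.prems(4) by (metis subset_antisym)
    next
      case False
      then show ?thesis using dich by metis
    qed
  next
    case False
    \<comment> \<open>Both I + aR and I : a are strictly larger than \<open>I\<close>: the first
      contains \<open>a\<close>, the second contains \<open>b\<close>.\<close>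
    then obtain a b where ab: "a \<in> carrier R" "b \<in> carrier R" "a \<otimes> b \<in> I" "a \<notin> I" "b \<notin> I"
      using primeidealI[OF step.hyps is_cring] by metis
    have pid: "ideal (PIdl a) R" by (rule cgenideal_ideal[OF ab(1)])
    let ?g = "\<lambda>J. J <+>\<^bsub>R\<^esub> PIdl a"
    let ?h = "\<lambda>J. {d \<in> carrier R. \<forall>c\<in>{a}. c \<otimes> d \<in> J}"
    have g: "ideal (?g J) R" "J \<subseteq> ?g J" "a \<in> ?g J" if "ideal J R" for J
      using add_ideals[OF that pid] ideal_sum_upper[OF that pid] cgenideal_self[OF ab(1)] by auto
    have h: "ideal (?h J) R" "J \<subseteq> ?h J" if "ideal J R" for J
      using colon_ideal[OF that, of "{a}"] ab(1) ideal.I_l_closed[OF that] ideal.Icarr[OF that] by auto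
    have gmono: "?g J \<subseteq> ?g K" if "J \<subseteq> K" "ideal K R" for J K
      using ideal_sum_least[OF g(1)[OF that(2)]] ideal_sum_upper[OF that(2) pid] that by blast
    have "\<exists>m. \<forall>n\<ge>m. ?g (f n) = ?g (f m)"
    proof (rule step.IH[OF g(1)[OF step.hyps]])
      show "I \<subset> ?g I" using g[OF step.hyps] ab(4) by blast
      then show "?g I \<noteq> {\<zero>}" using zero[OF step.hyps] step.prems(1) by blast
    qed (use g step.prems gmono in auto)
    then obtain m1 where m1: "\<And>n. n \<ge> m1 \<Longrightarrow> ?g (f n) = ?g (f m1)" by blast
    have "\<exists>m. \<forall>n\<ge>m. ?h (f n) = ?h (f m)"
    proof (rule step.IH[OF h(1)[OF step.hyps]])
      show "I \<subset> ?h I" using h[OF step.hyps] ab by blast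
      then show "?h I \<noteq> {\<zero>}" using zero[OF step.hyps] step.prems(1) by blast
    next
      show "ideal (?h (f n)) R" for n by (rule h(1)[OF step.prems(2)])
      show "?h (f (Suc n)) \<subseteq> ?h (f n)" for n using step.prems(3)[of n] by blast
      show "?h I \<subseteq> ?h (f n)" for n using step.prems(4)[of n] by blast
    qed
    then obtain m2 where m2: "\<And>n. n \<ge> m2 \<Longrightarrow> ?h (f n) = ?h (f m2)" by blast
    have "f n = f (max m1 m2)" if n: "n \<ge> max m1 m2" for n
    proof
      let ?m = "max m1 m2"
      show "f n \<subseteq> f ?m" by (rule dec[OF n])
      interpret fn: ideal "f n" R by (rule step.prems)
      interpret fm: ideal "f ?m" R by (rule step.prems)
      show "f ?m \<subseteq> f n"
      proof
        \<comment> \<open>A modular-law argument: writing x = j + d a with j in the smaller ideal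
          puts d into the quotient by \<open>a\<close>, which is the same for both ideals.\<close>
        fix x assume x: "x \<in> f ?m"
        have "?g (f n) = ?g (f ?m)" using m1[of n] m1[of ?m] n by simp
        then have "x \<in> ?g (f n)" using x g(2)[OF step.prems(2)[of ?m]] by blast
        then obtain j v where "j \<in> f n" "v \<in> PIdl a" "x = j \<oplus> v" unfolding ideal_sum_iff by blast
        then obtain d where jd: "j \<in> f n" "d \<in> carrier R" "x = j \<oplus> d \<otimes> a" unfolding cgenideal_def by blast
        have jc: "j \<in> carrier R" using jd fn.Icarr by blast
        have "a \<otimes> d = x \<ominus> j" unfolding jd(3) using jc jd(2) ab(1) by algebra
        then have "a \<otimes> d \<in> f ?m"
          using ideal_minus_closed[OF step.prems(2)[of ?m] x] jd(1) \<open>f n \<subseteq> f ?m\<close> by auto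
        then have "d \<in> ?h (f ?m)" using jd by auto
        moreover have "?h (f n) = ?h (f ?m)" using m2[of n] m2[of ?m] n by simp
        ultimately have "a \<otimes> d \<in> f n" by blast
        then show "x \<in> f n" using jd ab(1) by (simp add: m_comm)
      qed
    qed
    then show ?thesis by blast
  qed
qed

end

section \<open>Overrings\<close>

text \<open>Closure under negation comes from \<open>mult\<close>, since -1 lies in
  \<open>S\<close>.\<close>

lemma (in cring) ideal_subringI:
  assumes S: "subring S R" and I: "I \<subseteq> S" "\<zero> \<in> I"
    and add: "\<And>a b. a \<in> I \<Longrightarrow> b \<in> I \<Longrightarrow> a \<oplus> b \<in> I"
    and mult: "\<And>a x. a \<in> I \<Longrightarrow> x \<in> S \<Longrightarrow> x \<otimes> a \<in> I"
  shows "ideal I (R\<lparr>carrier := S\<rparr>)"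
proof -
  interpret S: ring "R\<lparr>carrier := S\<rparr>" by (rule subring_is_ring[OF S])
  have Sc: "\<And>x. x \<in> S \<Longrightarrow> x \<in> carrier R" using subringE(1)[OF S] by auto
  show ?thesis
  proof (rule idealI[OF S.ring_axioms])
    show "subgroup I (add_monoid (R\<lparr>carrier := S\<rparr>))"
    proof (rule S.add.subgroupI)
      fix a assume a: "a \<in> I"
      then have "\<ominus>\<^bsub>R\<lparr>carrier := S\<rparr>\<^esub> a = (\<ominus>\<^bsub>R\<lparr>carrier := S\<rparr>\<^esub> \<one>) \<otimes> a"
        using S.l_minus[of \<one> a] subringE(3)[OF S] I(1) Sc by auto
      then show "\<ominus>\<^bsub>R\<lparr>carrier := S\<rparr>\<^esub> a \<in> I"
        using mult[OF a] S.a_inv_closed[of \<one>] subringE(3)[OF S] by simp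
    qed (use I add in auto)
  next
    fix a x assume a: "a \<in> I" and x: "x \<in> carrier (R\<lparr>carrier := S\<rparr>)"
    then have "x \<otimes> a \<in> I" using mult by simp
    moreover have "a \<otimes> x = x \<otimes> a" using a x I(1) Sc by (intro m_comm) auto
    ultimately show "x \<otimes>\<^bsub>R\<lparr>carrier := S\<rparr>\<^esub> a \<in> I" "a \<otimes>\<^bsub>R\<lparr>carrier := S\<rparr>\<^esub> x \<in> I" by auto
  qed
qed

lemma (in ring) ideal_subringD:
  assumes "ideal I (R\<lparr>carrier := S\<rparr>)"
  shows "I \<subseteq> S" "\<zero> \<in> I" "\<And>a b. a \<in> I \<Longrightarrow> b \<in> I \<Longrightarrow> a \<oplus> b \<in> I"
    "\<And>a x. a \<in> I \<Longrightarrow> x \<in> S \<Longrightarrow> x \<otimes> a \<in> I" "\<And>a x. a \<in> I \<Longrightarrow> x \<in> S \<Longrightarrow> a \<otimes> x \<in> I"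
proof -
  interpret I: ideal I "R\<lparr>carrier := S\<rparr>" by fact
  show "I \<subseteq> S" "\<zero> \<in> I" "\<And>a b. a \<in> I \<Longrightarrow> b \<in> I \<Longrightarrow> a \<oplus> b \<in> I"
    "\<And>a x. a \<in> I \<Longrightarrow> x \<in> S \<Longrightarrow> x \<otimes> a \<in> I" "\<And>a x. a \<in> I \<Longrightarrow> x \<in> S \<Longrightarrow> a \<otimes> x \<in> I"
    using I.a_subset additive_subgroup.zero_closed[OF I.is_additive_subgroup]
      additive_subgroup.a_closed[OF I.is_additive_subgroup] I.I_l_closed I.I_r_closed by auto
qed

locale noetherian_overring = field K for K (structure) +
  fixes D S
  assumes quot: "is_quotient_field K D"
    and S: "subring S K" and DS: "D \<subseteq> S"
    and noeth: "noetherian_domain (K\<lparr>carrier := D\<rparr>)"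
    and lpv: "locally_pseudo_valuation (K\<lparr>carrier := D\<rparr>)"
begin

sublocale R: noetherian_domain "K\<lparr>carrier := D\<rparr>"
  by (rule noeth)

sublocale T: domain "K\<lparr>carrier := S\<rparr>"
  by (rule subring_is_domain[OF S])

lemma D: "subring D K"
  using quot by (simp add: is_quotient_field_def)

lemma D_carrier: "x \<in> D \<Longrightarrow> x \<in> carrier K"
  using subringE(1)[OF D] by auto

lemma S_carrier: "x \<in> S \<Longrightarrow> x \<in> carrier K"
  using subringE(1)[OF S] by auto

lemma D_pow: "x \<in> D \<Longrightarrow> x [^] (n::nat) \<in> D"
  by (induction n) (auto simp: subringE[OF D])

lemma nonzero_inv:
  assumes "x \<in> carrier K" "x \<noteq> \<zero>"
  shows "inv x \<in> carrier K" "x \<otimes> inv x = \<one>" "inv x \<otimes> x = \<one>" "inv x \<noteq> \<zero>"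
proof -
  have "x \<in> Units K" using assms field_Units by simp
  then show "inv x \<in> carrier K" "x \<otimes> inv x = \<one>" "inv x \<otimes> x = \<one>" "inv x \<noteq> \<zero>"
    using Units_inv_Units[of x] field_Units by auto
qed

lemma fractionE:
  assumes "z \<in> carrier K"
  obtains a b where "a \<in> D" "b \<in> D" "b \<noteq> \<zero>" "z = a \<otimes> inv b" "z \<otimes> b = a"
proof -
  obtain a b where ab: "a \<in> D" "b \<in> D" "b \<noteq> \<zero>" "z = a \<otimes> inv b"
    using quot assms unfolding is_quotient_field_def by blast
  then have "z \<otimes> b = a" using nonzero_inv[of b] D_carrier by (simp add: m_assoc)
  then show ?thesis using that ab by blast
qed

section \<open>Overrings are Noetherian\<close>

text \<open>As in the proof of the Krull-Akizuki theorem, \<open>S \<subseteq> p\<^sup>-\<^sup>n D + pS\<close> for some \<open>n\<close>.\<close>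

lemma krull_akizuki:
  assumes p: "p \<in> D" "p \<noteq> \<zero>"
  shows "\<exists>n::nat. \<forall>y\<in>S. \<exists>u\<in>D. \<exists>z\<in>S. p [^] n \<otimes> y = u \<oplus> p [^] Suc n \<otimes> z"
proof -
  have pc: "p \<in> carrier K" and pS: "p \<in> S" using p D_carrier DS by auto
  \<comment> \<open>Divided by p^m, this says that y lies in p^(-m) D + pS.\<close>
  define P where "P m y \<longleftrightarrow> (\<exists>u\<in>D. \<exists>z\<in>S. p [^] m \<otimes> y = u \<oplus> p [^] Suc m \<otimes> z)" for m :: nat and y
  have stable: "\<exists>m. \<forall>n\<ge>m. f n = f m"
    if "\<And>n. ideal (f n) (K\<lparr>carrier := D\<rparr>)" "\<And>n. f (Suc n) \<subseteq> f n" "c \<in> D" "c \<noteq> \<zero>" "\<And>n. c \<in> f n"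
    for f :: "nat \<Rightarrow> 'a set" and c
  proof -
    have "ideal (PIdl\<^bsub>K\<lparr>carrier := D\<rparr>\<^esub> c) (K\<lparr>carrier := D\<rparr>)"
      using that by (intro R.cgenideal_ideal) simp
    moreover have "PIdl\<^bsub>K\<lparr>carrier := D\<rparr>\<^esub> c \<noteq> {\<zero>}"
      using R.cgenideal_self[of c] that by auto
    ultimately show ?thesis
      using R.descending_chain_stable[OF R.nonzero_prime_maximal[OF lpv], of _ f]
        R.cgenideal_minimal that by auto
  qed
  \<comment> \<open>An exponent depending on y: for y = b/c the chain cD + p^m D stops, so p^m lies
    in cD + p^(m+1) D, and multiplying by y clears the denominator.\<close>
  have ex: "\<exists>m. P m y" if y: "y \<in> S" for y
  proof -
    obtain b c where bc: "b \<in> D" "c \<in> D" "c \<noteq> \<zero>" "y \<otimes> c = b"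
      using fractionE S_carrier[OF y] by metis
    define f where "f m = {d. \<exists>e\<in>D. \<exists>g\<in>D. d = c \<otimes> e \<oplus> p [^] m \<otimes> g}" for m :: nat
    have fid: "ideal (f m) (K\<lparr>carrier := D\<rparr>)" for m
    proof (rule ideal_subringI[OF D])
      show "f m \<subseteq> D" using bc p D_pow by (auto simp: f_def subringE[OF D])
      have "\<zero> = c \<otimes> \<zero> \<oplus> p [^] m \<otimes> \<zero>" using bc pc D_carrier by simp
      then show "\<zero> \<in> f m" unfolding f_def using subringE(2)[OF D] by blast
    next
      fix d1 d2 assume "d1 \<in> f m" "d2 \<in> f m"
      then obtain e1 g1 e2 g2 where d: "e1 \<in> D" "g1 \<in> D" "d1 = c \<otimes> e1 \<oplus> p [^] m \<otimes> g1"
        "e2 \<in> D" "g2 \<in> D" "d2 = c \<otimes> e2 \<oplus> p [^] m \<otimes> g2" unfolding f_def by blast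
      have car: "e1 \<in> carrier K" "g1 \<in> carrier K" "e2 \<in> carrier K" "g2 \<in> carrier K" "c \<in> carrier K" "p [^] m \<in> carrier K"
        using d bc pc D_carrier by auto
      have "d1 \<oplus> d2 = c \<otimes> (e1 \<oplus> e2) \<oplus> p [^] m \<otimes> (g1 \<oplus> g2)"
        unfolding d using car by algebra
      then show "d1 \<oplus> d2 \<in> f m" unfolding f_def using d subringE(7)[OF D] by blast
    next
      fix d x assume "d \<in> f m" and x: "x \<in> D"
      then obtain e g where d: "e \<in> D" "g \<in> D" "d = c \<otimes> e \<oplus> p [^] m \<otimes> g" unfolding f_def by blast
      have car: "e \<in> carrier K" "g \<in> carrier K" "c \<in> carrier K" "p [^] m \<in> carrier K" "x \<in> carrier K"
        using d bc pc x D_carrier by auto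
      have "x \<otimes> d = c \<otimes> (x \<otimes> e) \<oplus> p [^] m \<otimes> (x \<otimes> g)"
        unfolding d using car by algebra
      then show "x \<otimes> d \<in> f m" unfolding f_def using d x subringE(6)[OF D] by blast
    qed
    have dec: "f (Suc m) \<subseteq> f m" for m
    proof
      fix d assume "d \<in> f (Suc m)"
      then obtain e g where d: "e \<in> D" "g \<in> D" "d = c \<otimes> e \<oplus> p [^] Suc m \<otimes> g" unfolding f_def by blast
      then have "d = c \<otimes> e \<oplus> p [^] m \<otimes> (p \<otimes> g)" using D_carrier pc by (simp add: m_assoc)
      then show "d \<in> f m" unfolding f_def using d p subringE(6)[OF D] by blast
    qed
    have cf: "c \<in> f m" for m
    proof -
      have "c = c \<otimes> \<one> \<oplus> p [^] m \<otimes> \<zero>" using bc pc D_carrier by simp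
      then show ?thesis unfolding f_def using subringE[OF D] by blast
    qed
    obtain m where m: "f (Suc m) = f m"
      using stable[of f, OF fid dec bc(2,3) cf] by (metis le_Suc_eq order_refl)
    have "p [^] m = c \<otimes> \<zero> \<oplus> p [^] m \<otimes> \<one>" using bc pc D_carrier by simp
    then have "p [^] m \<in> f (Suc m)" unfolding m unfolding f_def using subringE[OF D] by blast
    then obtain e g where eg: "e \<in> D" "g \<in> D" "p [^] m = c \<otimes> e \<oplus> p [^] Suc m \<otimes> g"
      unfolding f_def by blast
    have car: "e \<in> carrier K" "g \<in> carrier K" "c \<in> carrier K" "p [^] Suc m \<in> carrier K" "y \<in> carrier K"
      using eg bc pc y D_carrier S_carrier by auto
    have "p [^] m \<otimes> y = (y \<otimes> c) \<otimes> e \<oplus> p [^] Suc m \<otimes> (g \<otimes> y)"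
      unfolding eg(3) using car by algebra
    moreover have "(y \<otimes> c) \<otimes> e \<in> D" "g \<otimes> y \<in> S" using eg bc y DS subringE(6)[OF D] subringE(6)[OF S] by auto
    ultimately show ?thesis unfolding P_def by blast
  qed
  have up: "P (Suc m) y" if h: "P m y" "y \<in> S" for m y
  proof -
    obtain u z where uz: "u \<in> D" "z \<in> S" "p [^] m \<otimes> y = u \<oplus> p [^] Suc m \<otimes> z"
      using h unfolding P_def by blast
    have car: "u \<in> carrier K" "z \<in> carrier K" "y \<in> carrier K" using uz that D_carrier S_carrier by auto
    have "p [^] Suc m \<otimes> y = p \<otimes> (p [^] m \<otimes> y)" using pc car by (simp add: m_ac)
    also have "\<dots> = p \<otimes> u \<oplus> p [^] Suc (Suc m) \<otimes> z" unfolding uz(3) using pc car by (simp add: r_distr m_ac)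
    finally show ?thesis unfolding P_def using uz p subringE(6)[OF D] by blast
  qed
  \<comment> \<open>The traces on \<open>D\<close> of p^k S + pD all contain \<open>p\<close>. The
    index where they stop is the exponent that serves every y.\<close>
  define J where "J k = {d \<in> D. \<exists>z\<in>S. \<exists>u\<in>D. d = p [^] k \<otimes> z \<oplus> p \<otimes> u}" for k :: nat
  have Jid: "ideal (J k) (K\<lparr>carrier := D\<rparr>)" for k
  proof (rule ideal_subringI[OF D])
    show "J k \<subseteq> D" by (auto simp: J_def)
    have "\<zero> = p [^] k \<otimes> \<zero> \<oplus> p \<otimes> \<zero>" using pc by simp
    then show "\<zero> \<in> J k" unfolding J_def using subringE(2)[OF D] subringE(2)[OF S] by blast
  next
    fix d1 d2 assume "d1 \<in> J k" "d2 \<in> J k"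
    then obtain z1 u1 z2 u2 where d: "z1 \<in> S" "u1 \<in> D" "d1 = p [^] k \<otimes> z1 \<oplus> p \<otimes> u1"
      "z2 \<in> S" "u2 \<in> D" "d2 = p [^] k \<otimes> z2 \<oplus> p \<otimes> u2" and dD: "d1 \<in> D" "d2 \<in> D" unfolding J_def by blast
    have car: "z1 \<in> carrier K" "z2 \<in> carrier K" "u1 \<in> carrier K" "u2 \<in> carrier K" "p [^] k \<in> carrier K"
      using d pc D_carrier S_carrier by auto
    have "d1 \<oplus> d2 = p [^] k \<otimes> (z1 \<oplus> z2) \<oplus> p \<otimes> (u1 \<oplus> u2)"
      unfolding d using car pc by algebra
    then show "d1 \<oplus> d2 \<in> J k"
      unfolding J_def using d dD subringE(7)[OF D] subringE(7)[OF S] by blast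
  next
    fix d x assume "d \<in> J k" and x: "x \<in> D"
    then obtain z u where d: "z \<in> S" "u \<in> D" "d = p [^] k \<otimes> z \<oplus> p \<otimes> u" and dD: "d \<in> D" unfolding J_def by blast
    have car: "z \<in> carrier K" "u \<in> carrier K" "p [^] k \<in> carrier K" "x \<in> carrier K"
      using d pc x D_carrier S_carrier by auto
    have "x \<otimes> d = p [^] k \<otimes> (x \<otimes> z) \<oplus> p \<otimes> (x \<otimes> u)"
      unfolding d using car pc by algebra
    then show "x \<otimes> d \<in> J k"
      unfolding J_def using d dD x DS subringE(6)[OF D] subringE(6)[OF S] by blast
  qed
  have Jdec: "J (Suc k) \<subseteq> J k" for k
  proof
    fix d assume "d \<in> J (Suc k)"
    then obtain z u where d: "z \<in> S" "u \<in> D" "d = p [^] Suc k \<otimes> z \<oplus> p \<otimes> u" and dD: "d \<in> D" unfolding J_def by blast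
    then have "d = p [^] k \<otimes> (p \<otimes> z) \<oplus> p \<otimes> u" using S_carrier pc by (simp add: m_assoc)
    then show "d \<in> J k" unfolding J_def using d dD pS subringE(6)[OF S] by blast
  qed
  have pJ: "p \<in> J k" for k
  proof -
    have "p = p [^] k \<otimes> \<zero> \<oplus> p \<otimes> \<one>" using pc by simp
    then show ?thesis unfolding J_def using p subringE[OF D] subringE[OF S] by blast
  qed
  obtain n where n: "\<And>k. k \<ge> n \<Longrightarrow> J k = J n"
    using stable[of J, OF Jid Jdec p pJ] by blast
  \<comment> \<open>The remainder u lies in J (k+1) = J (k+2), so it can be rewritten as a multiple
    of \<open>p\<close> in \<open>D\<close> plus an element of p^(k+2) S; then one factor
    \<open>p\<close> cancels.\<close>
  have down: "P k y" if h: "k \<ge> n" "P (Suc k) y" "y \<in> S" for k y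
  proof -
    obtain u z where uz: "u \<in> D" "z \<in> S" "p [^] Suc k \<otimes> y = u \<oplus> p [^] Suc (Suc k) \<otimes> z"
      using h unfolding P_def by blast
    have car: "u \<in> carrier K" "z \<in> carrier K" "y \<in> carrier K" "p [^] k \<in> carrier K" using pc uz that D_carrier S_carrier by auto
    have "p [^] Suc k \<otimes> (y \<ominus> p \<otimes> z) = p [^] Suc k \<otimes> y \<ominus> p [^] Suc (Suc k) \<otimes> z"
      using car pc by (simp add: a_minus_def r_distr r_minus m_assoc)
    also have "\<dots> = u" unfolding uz(3) using car pc by (simp add: a_minus_def a_assoc r_neg)
    finally have "u = p [^] Suc k \<otimes> (y \<ominus> p \<otimes> z) \<oplus> p \<otimes> \<zero>" using car pc by simp
    moreover have "y \<ominus> p \<otimes> z \<in> S"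
      using that uz pS subringE[OF S] by (simp add: a_minus_def)
    ultimately have "u \<in> J (Suc k)" unfolding J_def using uz subringE(2)[OF D] by blast
    then have "u \<in> J (Suc (Suc k))" using n[of "Suc k"] n[of "Suc (Suc k)"] that by simp
    then obtain z' u' where z': "z' \<in> S" "u' \<in> D" "u = p [^] Suc (Suc k) \<otimes> z' \<oplus> p \<otimes> u'"
      unfolding J_def by blast
    have car': "z' \<in> carrier K" "u' \<in> carrier K" using z' D_carrier S_carrier by auto
    have "p \<otimes> (p [^] k \<otimes> y) = p [^] Suc k \<otimes> y" using car pc by (simp add: m_ac)
    also have "\<dots> = p \<otimes> (u' \<oplus> p [^] Suc k \<otimes> (z' \<oplus> z))"
      unfolding uz(3) z'(3) using car car' pc by (simp add: r_distr m_ac a_ac)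
    finally have "p [^] k \<otimes> y = u' \<oplus> p [^] Suc k \<otimes> (z' \<oplus> z)"
      using m_lcancel[OF p(2) pc] car car' pc by (metis m_closed a_closed nat_pow_closed)
    then show ?thesis unfolding P_def using z' uz subringE(7)[OF S] by blast
  qed
  have "P n y" if y: "y \<in> S" for y
  proof -
    obtain m where m: "P m y" using ex[OF y] by blast
    show ?thesis
    proof (cases "m \<le> n")
      case True
      then show ?thesis using m by (induction rule: dec_induct) (use up y in auto)
    next
      case False
      have "P (n + j) y \<Longrightarrow> P n y" for j
        by (induction j) (use down[of "n + _"] y in auto)
      then show ?thesis using m False by (metis le_add_diff_inverse nat_le_linear)
    qed
  qed
  then show ?thesis unfolding P_def by blast
qed

text \<open>Ideals I of \<open>S\<close> containing a fixed nonzero p of \<open>D\<close> are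
  determined by the traces on \<open>D\<close> of p^n I, with n from \<open>krull_akizuki\<close>:
  subtracting a multiple of p moves p^n i into \<open>D\<close>. Chains in \<open>S\<close>
  therefore stop as they do in \<open>D\<close>.\<close>

lemma overring_noetherian: "noetherian_domain (K\<lparr>carrier := S\<rparr>)"
proof -
  have "noetherian_ring (K\<lparr>carrier := S\<rparr>)"
  proof (rule T.trivial_ideal_chain_imp_noetherian)
    fix C assume C: "C \<noteq> {}" "subset.chain {I. ideal I (K\<lparr>carrier := S\<rparr>)} C"
    have id: "ideal I (K\<lparr>carrier := S\<rparr>)" if "I \<in> C" for I
      using C(2) that unfolding pred_on.chain_def by auto
    have tot: "I \<subseteq> J \<or> J \<subseteq> I" if "I \<in> C" "J \<in> C" for I J
      using C(2) that unfolding pred_on.chain_def by auto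
    show "\<Union>C \<in> C"
    proof (cases "\<forall>I\<in>C. I = {\<zero>}")
      case True
      then have "C = {{\<zero>}}" using C(1) by auto
      then show ?thesis by simp
    next
      case False
      then obtain I0 y where I0: "I0 \<in> C" "y \<in> I0" "y \<noteq> \<zero>"
        using ideal_subringD(2)[OF id] by blast
      have yS: "y \<in> S" using ideal_subringD(1)[OF id[OF I0(1)]] I0 by auto
      obtain p c where pc: "p \<in> D" "c \<in> D" "c \<noteq> \<zero>" "y \<otimes> c = p"
        using fractionE S_carrier[OF yS] by metis
      have p0: "p \<noteq> \<zero>" using pc I0 integral[of y c] S_carrier[OF yS] D_carrier by auto
      have pI0: "p \<in> I0" using ideal_subringD(5)[OF id[OF I0(1)] I0(2)] pc DS by auto
      have pK: "p \<in> carrier K" using pc D_carrier by auto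
      obtain n :: nat where n: "\<And>y. y \<in> S \<Longrightarrow> \<exists>u\<in>D. \<exists>z\<in>S. p [^] n \<otimes> y = u \<oplus> p [^] Suc n \<otimes> z"
        using krull_akizuki[OF pc(1) p0] by blast
      define g where "g I = {d \<in> D. \<exists>i\<in>I. d = p [^] n \<otimes> i}" for I
      have pn: "p [^] n \<in> carrier K" "p [^] n \<noteq> \<zero>" using pK p0
        by (simp, induction n) (use integral in auto)
      have gid: "ideal (g I) (K\<lparr>carrier := D\<rparr>)" if I: "I \<in> C" for I
      proof (rule ideal_subringI[OF D])
        note I = ideal_subringD[OF id[OF I]]
        have Ic: "\<And>i. i \<in> I \<Longrightarrow> i \<in> carrier K" using I(1) S_carrier by auto
        show "g I \<subseteq> D" by (auto simp: g_def)
        show "\<zero> \<in> g I" using I(2) pn subringE(2)[OF D] by (auto simp: g_def intro!: bexI[of _ \<zero>])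
        show "a \<oplus> b \<in> g I" if ab: "a \<in> g I" "b \<in> g I" for a b
        proof -
          obtain i j where ij: "i \<in> I" "j \<in> I" "a = p [^] n \<otimes> i" "b = p [^] n \<otimes> j" and abD: "a \<in> D" "b \<in> D"
            using ab unfolding g_def by blast
          have "a \<oplus> b = p [^] n \<otimes> (i \<oplus> j)" unfolding ij using ij(1,2) Ic pn by (simp add: r_distr)
          then show ?thesis unfolding g_def using I(3) ij abD subringE(7)[OF D] by blast
        qed
        show "x \<otimes> a \<in> g I" if a: "a \<in> g I" and x: "x \<in> D" for a x
        proof -
          obtain i where i: "i \<in> I" "a = p [^] n \<otimes> i" and aD: "a \<in> D"
            using a unfolding g_def by blast
          have "x \<otimes> a = p [^] n \<otimes> (x \<otimes> i)" unfolding i using i(1) Ic pn x D_carrier by (simp add: m_lcomm)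
          then show ?thesis unfolding g_def using I(4) i aD x DS subringE(6)[OF D] by blast
        qed
      qed
      obtain U where U: "\<exists>I\<in>C. I0 \<subseteq> I \<and> U = g I"
        and max: "\<And>J. ideal J (K\<lparr>carrier := D\<rparr>) \<Longrightarrow> \<exists>I\<in>C. I0 \<subseteq> I \<and> J = g I \<Longrightarrow> U \<subseteq> J \<Longrightarrow> J = U"
        by (rule R.exists_maximal_ideal_with[OF gid[OF I0(1)], of "\<lambda>J. \<exists>I\<in>C. I0 \<subseteq> I \<and> J = g I"])
          (use I0 in blast)+
      then obtain I1 where I1: "I1 \<in> C" "I0 \<subseteq> I1" "U = g I1" by blast
      have "I \<subseteq> I1" if I: "I \<in> C" for I
      proof (cases "I \<subseteq> I1")
        case False
        then have sub: "I1 \<subseteq> I" using tot I I1 by blast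
        then have "g I = g I1"
          using max[OF gid[OF I]] I I1 unfolding g_def by blast
        show ?thesis
        proof
          fix i assume i: "i \<in> I"
          note idI = ideal_subringD[OF id[OF I]] and id1 = ideal_subringD[OF id[OF I1(1)]]
          have iS: "i \<in> S" using i idI by auto
          obtain u z where uz: "u \<in> D" "z \<in> S" "p [^] n \<otimes> i = u \<oplus> p [^] Suc n \<otimes> z"
            using n[OF iS] by blast
          have car: "i \<in> carrier K" "u \<in> carrier K" "z \<in> carrier K" using iS uz D_carrier S_carrier by auto
          have pI: "p \<in> I" "p \<in> I1" using pI0 I1(2) sub by auto
          have "\<ominus> z \<in> S" using uz subringE(5)[OF S] by auto
          then have "i \<oplus> p \<otimes> (\<ominus> z) \<in> I" using idI(3)[OF i idI(5)[OF pI(1)]] by blast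
          moreover have "u = p [^] n \<otimes> (i \<oplus> p \<otimes> (\<ominus> z))"
          proof -
            have "p [^] n \<otimes> (i \<oplus> p \<otimes> (\<ominus> z)) = p [^] n \<otimes> i \<oplus> \<ominus> (p [^] Suc n \<otimes> z)"
              using car pn pK by (simp add: r_distr r_minus m_assoc)
            also have "\<dots> = u" unfolding uz(3) using car pn pK by (simp add: a_assoc r_neg)
            finally show ?thesis by simp
          qed
          ultimately have "u \<in> g I" unfolding g_def using uz by blast
          then have "u \<in> g I1" using \<open>g I = g I1\<close> by simp
          then obtain j where j: "j \<in> I1" "u = p [^] n \<otimes> j" unfolding g_def by blast
          have jc: "j \<in> carrier K" using j id1 S_carrier by auto
          have "p [^] n \<otimes> i = p [^] n \<otimes> (j \<oplus> p \<otimes> z)"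
            unfolding uz(3) j(2) using jc car pn pK by (simp add: r_distr m_assoc)
          then have "i = j \<oplus> p \<otimes> z" using m_lcancel[OF pn(2,1)] jc car pK by simp
          then show "i \<in> I1" using id1(3)[OF j(1) id1(5)[OF pI(2) uz(2)]] by simp
        qed
      qed
      then have "\<Union>C = I1" using I1 by auto
      then show ?thesis using I1 by simp
    qed
  qed
  then show ?thesis by (intro noetherian_domain.intro T.domain_axioms)
qed

end

section \<open>The valuation ring above a localization\<close>

text \<open>For \<open>x \<in> M - M\<^sup>2\<close> the set \<open>Mloc\<close> below is the maximal ideal \<open>MD\<^sub>M\<close> of \<open>D\<^sub>M\<close> and
  \<open>V = x\<^sup>-\<^sup>1 Mloc\<close> is the valuation ring with the same maximal ideal.\<close>

locale noetherian_overring_at = noetherian_overring +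
  fixes M x
  assumes M: "maximalideal M (K\<lparr>carrier := D\<rparr>)" "M \<noteq> {\<zero>}"
    and x: "x \<in> M - ideal_prod (K\<lparr>carrier := D\<rparr>) M M"
begin

sublocale M: primeideal M "K\<lparr>carrier := D\<rparr>"
  by (rule R.maximalideal_prime[OF M(1)])

lemma M_nonzero: "M \<noteq> {\<zero>\<^bsub>K\<lparr>carrier := D\<rparr>\<^esub>}"
  using M(2) by simp

lemmas M_ideal = ideal_subringD[OF M.is_ideal]

lemma M_carrier: "z \<in> M \<Longrightarrow> z \<in> carrier K"
  using M_ideal(1) D_carrier by auto

lemma mult_notin_M: "s \<in> D - M \<Longrightarrow> t \<in> D - M \<Longrightarrow> s \<otimes> t \<in> D - M"
  using M.mult_notin[of s t] by simp

lemma cofactor: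
  assumes "b \<in> M - ideal_prod (K\<lparr>carrier := D\<rparr>) M M" "p \<in> ideal_prod (K\<lparr>carrier := D\<rparr>) M M"
  obtains s q where "s \<in> D - M" "q \<in> M" "s \<otimes> p = b \<otimes> q"
  using R.square_cofactor[OF lpv M(1) M_nonzero assms] by auto

lemma square_mem: "a \<in> M \<Longrightarrow> b \<in> M \<Longrightarrow> a \<otimes> b \<in> ideal_prod (K\<lparr>carrier := D\<rparr>) M M"
  using ideal_prod.prod[of a M b M "K\<lparr>carrier := D\<rparr>"] by simp

lemma x_carrier: "x \<in> carrier K" and x_nonzero: "x \<noteq> \<zero>"
proof -
  show "x \<in> carrier K" using x M_carrier by auto
  have "\<zero> = \<zero> \<otimes> \<zero>" by simp
  then show "x \<noteq> \<zero>" using x square_mem[OF M_ideal(2) M_ideal(2)] by auto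
qed

definition Mloc where "Mloc = {z \<in> carrier K. \<exists>s\<in>D - M. s \<otimes> z \<in> M}"

definition V where "V = {z \<in> carrier K. x \<otimes> z \<in> Mloc}"

lemma MlocI: "z \<in> carrier K \<Longrightarrow> s \<in> D - M \<Longrightarrow> s \<otimes> z \<in> M \<Longrightarrow> z \<in> Mloc"
  unfolding Mloc_def by auto

lemma MlocE:
  assumes "z \<in> Mloc" obtains s where "z \<in> carrier K" "s \<in> D - M" "s \<otimes> z \<in> M"
  using assms unfolding Mloc_def by auto

lemma Mloc_mult:
  assumes "z \<in> Mloc" "d \<in> D" shows "d \<otimes> z \<in> Mloc"
proof -
  obtain s where s: "z \<in> carrier K" "s \<in> D - M" "s \<otimes> z \<in> M" using assms(1) by (rule MlocE)
  have "s \<otimes> (d \<otimes> z) = d \<otimes> (s \<otimes> z)" using s assms(2) D_carrier by (simp add: m_lcomm)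
  then have "s \<otimes> (d \<otimes> z) \<in> M" using M_ideal(4)[OF s(3) assms(2)] by simp
  then show ?thesis using s assms(2) D_carrier by (intro MlocI[of _ s]) auto
qed

lemma Mloc_cancel:
  assumes "z \<in> carrier K" "s \<in> D - M" "s \<otimes> z \<in> Mloc" shows "z \<in> Mloc"
proof -
  obtain t where t: "t \<in> D - M" "t \<otimes> (s \<otimes> z) \<in> M" using assms(3) by (rule MlocE)
  have "(t \<otimes> s) \<otimes> z \<in> M" using t assms D_carrier by (simp add: m_assoc)
  then show ?thesis using mult_notin_M[OF t(1) assms(2)] assms(1) by (intro MlocI) auto
qed

text \<open>The local identity M^2 = x M transferred to \<open>K\<close>. It makes \<open>V\<close>
  closed under products.\<close>

lemma Mloc_square:
  assumes "a \<in> Mloc" "b \<in> Mloc"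
  obtains c where "c \<in> Mloc" "a \<otimes> b = x \<otimes> c"
proof -
  obtain s where s: "a \<in> carrier K" "s \<in> D - M" "s \<otimes> a \<in> M" using assms(1) by (rule MlocE)
  obtain t where t: "b \<in> carrier K" "t \<in> D - M" "t \<otimes> b \<in> M" using assms(2) by (rule MlocE)
  obtain u q where u: "u \<in> D - M" "q \<in> M" "u \<otimes> ((s \<otimes> a) \<otimes> (t \<otimes> b)) = x \<otimes> q"
    using cofactor[OF x square_mem[OF s(3) t(3)]] .
  let ?c = "inv x \<otimes> (a \<otimes> b)"
  note ix = nonzero_inv[OF x_carrier x_nonzero]
  have c: "s \<in> carrier K" "t \<in> carrier K" "u \<in> carrier K" "q \<in> carrier K"
    using s t u D_carrier M_carrier by auto
  have "a \<otimes> b = x \<otimes> ?c" using ix s(1) t(1) x_carrier by (simp flip: m_assoc)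
  moreover have "(u \<otimes> s \<otimes> t) \<otimes> ?c \<in> M"
  proof -
    have "(u \<otimes> s \<otimes> t) \<otimes> ?c = inv x \<otimes> (u \<otimes> ((s \<otimes> a) \<otimes> (t \<otimes> b)))"
      using c s(1) t(1) ix(1) by (simp add: m_ac)
    also have "\<dots> = q" unfolding u(3) using ix x_carrier c by (simp flip: m_assoc)
    finally show ?thesis using u(2) by simp
  qed
  then have "?c \<in> Mloc"
    using mult_notin_M s t u ix(1) by (intro MlocI[of _ "u \<otimes> s \<otimes> t"]) auto
  ultimately show ?thesis using that by blast
qed

lemma VI: "z \<in> carrier K \<Longrightarrow> s \<in> D - M \<Longrightarrow> s \<otimes> (x \<otimes> z) \<in> M \<Longrightarrow> z \<in> V"
  unfolding V_def using x_carrier by (auto intro: MlocI)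

lemma V_cancel:
  assumes "z \<in> carrier K" "s \<in> D - M" "s \<otimes> z \<in> V" shows "z \<in> V"
proof -
  have "s \<otimes> (x \<otimes> z) = x \<otimes> (s \<otimes> z)" using assms D_carrier x_carrier by (simp add: m_lcomm)
  then have "s \<otimes> (x \<otimes> z) \<in> Mloc" using assms(3) by (simp add: V_def)
  then have "x \<otimes> z \<in> Mloc"
    using Mloc_cancel[OF _ assms(2)] assms(1) x_carrier by simp
  then show ?thesis using assms(1) by (simp add: V_def)
qed

text \<open>Strip \<open>x\<close> from numerator and denominator simultaneously until one of them
  leaves M^2; then \<open>cofactor\<close> or a unit decides. The numerator changes along the way,
  so \<open>b\<close> is quantified inside the induction on \<open>c\<close>.\<close>

lemma V_dichotomy_fraction:
  assumes "c \<in> D" "c \<noteq> \<zero>"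
  shows "\<forall>b\<in>D. b \<noteq> \<zero> \<longrightarrow> b \<otimes> inv c \<in> V \<or> c \<otimes> inv b \<in> Mloc"
proof -
  let ?M2 = "ideal_prod (K\<lparr>carrier := D\<rparr>) M M"
  have M2M: "?M2 \<subseteq> M" using R.ideal_prod_inter[OF M.is_ideal M.is_ideal] by simp
  have outside: "c \<otimes> inv b \<in> Mloc" if "b \<in> D - M" "c \<in> M" for b c
  proof -
    have b: "b \<in> carrier K" "b \<noteq> \<zero>" using that D_carrier M_ideal(2) by auto
    have "b \<otimes> (c \<otimes> inv b) = c"
      using b nonzero_inv[OF b] M_carrier[OF that(2)] m_lcomm[of b c "inv b"] by simp
    then show ?thesis using that b nonzero_inv[OF b] M_carrier by (intro MlocI[of _ b]) auto
  qed
  have "c \<in> carrier (K\<lparr>carrier := D\<rparr>)" "c \<noteq> \<zero>\<^bsub>K\<lparr>carrier := D\<rparr>\<^esub>" using assms by auto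
  from lpv M(1) M_nonzero x this show ?thesis
  proof (induction rule: R.nonzero_induct)
    case (unit c)
    then have c: "c \<in> D - M" "c \<in> carrier K" "c \<noteq> \<zero>" using D_carrier M_ideal(2) by auto
    have "b \<otimes> inv c \<in> V" if b: "b \<in> D" for b
    proof -
      have bK: "b \<in> carrier K" using b D_carrier by simp
      have "c \<otimes> (x \<otimes> (b \<otimes> inv c)) = b \<otimes> x \<otimes> (c \<otimes> inv c)"
        using c bK nonzero_inv(1)[OF c(2,3)] x_carrier by (simp add: m_ac)
      also have "\<dots> = b \<otimes> x" using c bK nonzero_inv[OF c(2,3)] x_carrier by simp
      finally have "c \<otimes> (x \<otimes> (b \<otimes> inv c)) \<in> M" using M_ideal(4)[of x b] x b by simp
      then show ?thesis using c bK nonzero_inv(1)[OF c(2,3)] by (intro VI[of _ c]) auto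
    qed
    then show ?case by blast
  next
    case (uniformizer c)
    have c: "c \<in> carrier K" "c \<noteq> \<zero>"
      using uniformizer M_carrier square_mem[OF M_ideal(2) M_ideal(2)] by auto
    note ic = nonzero_inv[OF c]
    show ?case
    proof (intro ballI impI)
      fix b assume b: "b \<in> D" "b \<noteq> \<zero>"
      have bK: "b \<in> carrier K" using b D_carrier by simp
      show "b \<otimes> inv c \<in> V \<or> c \<otimes> inv b \<in> Mloc"
      proof (cases "b \<in> M")
        case True
        then obtain s q where s: "s \<in> D - M" "q \<in> M" "s \<otimes> (x \<otimes> b) = c \<otimes> q"
          using cofactor[OF uniformizer square_mem[of x b]] x by blast
        have "s \<otimes> (x \<otimes> (b \<otimes> inv c)) = (s \<otimes> (x \<otimes> b)) \<otimes> inv c"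
          using s(1) D_carrier x_carrier bK ic(1) by (simp add: m_assoc)
        also have "\<dots> = q \<otimes> (c \<otimes> inv c)" unfolding s(3) using M_carrier[OF s(2)] c ic(1) by (simp add: m_ac)
        also have "\<dots> = q" using ic(2) M_carrier[OF s(2)] by simp
        finally have "b \<otimes> inv c \<in> V" using s bK ic(1) by (intro VI[of _ s]) auto
        then show ?thesis ..
      qed (use outside uniformizer b in blast)
    qed
  next
    case (step c c1 s)
    have "c \<in> M" using step(1) M2M by auto
    then have c: "c \<in> carrier K" "c \<noteq> \<zero>" "c \<in> M" using M_carrier step(2) by auto
    note ic = nonzero_inv[OF c(1,2)]
    have s: "s \<in> D - M" "s \<in> carrier K" "s \<noteq> \<zero>" "s \<otimes> c = x \<otimes> c1" using step D_carrier M_ideal(2) by auto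
    have c1: "c1 \<in> carrier K" "c1 \<noteq> \<zero>" using step M_carrier by auto
    show ?case
    proof (intro ballI impI)
      fix b assume b: "b \<in> D" "b \<noteq> \<zero>"
      have bK: "b \<in> carrier K" using b D_carrier by simp
      note ib = nonzero_inv[OF bK b(2)]
      consider "b \<in> D - M" | "b \<in> M - ?M2" | "b \<in> ?M2" using b by auto
      then show "b \<otimes> inv c \<in> V \<or> c \<otimes> inv b \<in> Mloc"
      proof cases
        case 1
        then show ?thesis using outside c by blast
      next
        case 2
        obtain t q where t: "t \<in> D - M" "q \<in> M" "t \<otimes> c = b \<otimes> q" using cofactor[OF 2 step(1)] .
        have "t \<otimes> (c \<otimes> inv b) = (t \<otimes> c) \<otimes> inv b"
          using t(1) D_carrier c ib(1) by (simp add: m_assoc)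
        also have "\<dots> = q \<otimes> (b \<otimes> inv b)" unfolding t(3) using M_carrier[OF t(2)] bK ib(1) by (simp add: m_ac)
        also have "\<dots> = q" using ib(2) M_carrier[OF t(2)] by simp
        finally have "c \<otimes> inv b \<in> Mloc" using t c ib(1) by (intro MlocI[of _ t]) auto
        then show ?thesis ..
      next
        case 3
        obtain t b1 where t: "t \<in> D - M" "b1 \<in> M" "t \<otimes> b = x \<otimes> b1" using cofactor[OF x 3] .
        have tK: "t \<in> carrier K" "t \<noteq> \<zero>" and b1: "b1 \<in> carrier K" using t D_carrier M_carrier M_ideal(2) by auto
        have b10: "b1 \<noteq> \<zero>" using t(3) tK b bK x_carrier integral[of t b] by auto
        have sb1: "s \<otimes> b1 \<in> D" "s \<otimes> b1 \<noteq> \<zero>"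
          using M_ideal(1) M_ideal(4)[OF t(2), of s] s b1 b10 integral[of s b1] by auto
        have sb1K: "s \<otimes> b1 \<in> carrier K" using s b1 by simp
        \<comment> \<open>As fractions, b/c = (s b1)/(t c1), where \<open>t\<close> is a local unit
          and \<open>c1\<close> is the smaller denominator.\<close>
        have ratio: "(s \<otimes> b1) \<otimes> c = (t \<otimes> b) \<otimes> c1"
        proof -
          have "(s \<otimes> b1) \<otimes> c = (s \<otimes> c) \<otimes> b1" using s(2) b1 c(1) by (simp add: m_ac)
          also have "\<dots> = (x \<otimes> b1) \<otimes> c1" unfolding s(4) using x_carrier c1 b1 by (simp add: m_ac)
          finally show ?thesis using t(3) by simp
        qed
        from step(7) sb1 have "s \<otimes> b1 \<otimes> inv c1 \<in> V \<or> c1 \<otimes> inv (s \<otimes> b1) \<in> Mloc" by auto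
        then show ?thesis
        proof
          assume V: "s \<otimes> b1 \<otimes> inv c1 \<in> V"
          note ic1 = nonzero_inv[OF c1]
          have "s \<otimes> b1 \<otimes> inv c1 = (s \<otimes> b1 \<otimes> inv c1) \<otimes> (c \<otimes> inv c)"
            using sb1K ic(2) ic1(1) by simp
          also have "\<dots> = ((s \<otimes> b1) \<otimes> c) \<otimes> inv c1 \<otimes> inv c"
            using s(2) b1 c(1) ic(1) ic1(1) by (simp add: m_ac)
          also have "\<dots> = t \<otimes> (b \<otimes> inv c) \<otimes> (c1 \<otimes> inv c1)"
            unfolding ratio using tK bK c ic(1) c1 ic1(1) by (simp add: m_ac)
          also have "\<dots> = t \<otimes> (b \<otimes> inv c)" using ic1(2) tK bK ic(1) by simp
          finally show ?thesis using V_cancel[OF _ t(1)] V bK ic(1) by simp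
        next
          assume m: "c1 \<otimes> inv (s \<otimes> b1) \<in> Mloc"
          note isb = nonzero_inv[OF sb1K sb1(2)]
          have "c \<otimes> inv b = ((s \<otimes> b1) \<otimes> c) \<otimes> inv b \<otimes> inv (s \<otimes> b1)"
          proof -
            have "((s \<otimes> b1) \<otimes> c) \<otimes> inv b \<otimes> inv (s \<otimes> b1) = (c \<otimes> inv b) \<otimes> ((s \<otimes> b1) \<otimes> inv (s \<otimes> b1))"
              using s(2) b1 c(1) ib(1) isb(1) by (simp add: m_ac)
            then show ?thesis using isb(2) c ib(1) by simp
          qed
          also have "\<dots> = (t \<otimes> (c1 \<otimes> inv (s \<otimes> b1))) \<otimes> (b \<otimes> inv b)"
            unfolding ratio using tK bK ib(1) c1 isb(1) by (simp add: m_ac)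
          also have "\<dots> = t \<otimes> (c1 \<otimes> inv (s \<otimes> b1))" using ib(2) tK c1 isb(1) by simp
          finally show ?thesis using Mloc_mult[OF m, of t] t by simp
        qed
      qed
    qed
  qed
qed

lemma V_dichotomy:
  assumes z: "z \<in> carrier K" "z \<notin> V"
  shows "z \<noteq> \<zero>" "inv z \<in> Mloc"
proof -
  obtain b c where bc: "b \<in> D" "c \<in> D" "c \<noteq> \<zero>" "z = b \<otimes> inv c" "z \<otimes> c = b" using z(1) by (rule fractionE)
  have "\<zero> \<in> Mloc" using M_ideal(2) M.one_notin subringE(3)[OF D] by (intro MlocI[of _ \<one>]) auto
  then have "\<zero> \<in> V" using x_carrier by (simp add: V_def)
  then show z0: "z \<noteq> \<zero>" using z by auto
  have K: "b \<in> carrier K" "c \<in> carrier K" using bc D_carrier by auto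
  have b0: "b \<noteq> \<zero>" using bc z0 z K integral[of z c] by auto
  have "c \<otimes> inv b \<in> Mloc" using V_dichotomy_fraction[OF bc(2,3)] bc b0 z by auto
  moreover have "c \<otimes> inv b = inv z"
  proof -
    have "c \<otimes> inv b = inv z \<otimes> (z \<otimes> c) \<otimes> inv b"
      using nonzero_inv[OF z(1) z0] z(1) K nonzero_inv[OF K(1) b0] by (simp flip: m_assoc)
    also have "\<dots> = inv z" unfolding bc(5) using nonzero_inv[OF z(1) z0] K nonzero_inv[OF K(1) b0] by (simp add: m_assoc)
    finally show ?thesis .
  qed
  ultimately show "inv z \<in> Mloc" by simp
qed

text \<open>The product of x w^i and x w lies in x times \<open>Mloc\<close>, so one
  \<open>x\<close> cancels at every step: the same \<open>x\<close> is a common denominator for all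
  powers of \<open>w\<close>.\<close>

lemma V_pow:
  assumes "w \<in> V" shows "x \<otimes> w [^] Suc i \<in> Mloc"
proof (induction i)
  case 0
  then show ?case using assms by (simp add: V_def)
next
  case (Suc i)
  have w: "w \<in> carrier K" "x \<otimes> w \<in> Mloc" using assms by (auto simp: V_def)
  obtain c where c: "c \<in> Mloc" "(x \<otimes> w [^] Suc i) \<otimes> (x \<otimes> w) = x \<otimes> c"
    using Mloc_square[OF Suc w(2)] .
  have "x \<otimes> (x \<otimes> w [^] Suc (Suc i)) = x \<otimes> c"
    unfolding c(2)[symmetric] using x_carrier w by (simp add: m_ac)
  then have "x \<otimes> w [^] Suc (Suc i) = c"
    using m_lcancel[OF x_nonzero x_carrier] x_carrier w c(1) by (auto simp: Mloc_def)
  then show ?case using c(1) by simp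
qed

text \<open>With \<open>w = 1/a\<close> the \<open>S\<close>-modules \<open>x w\<^sup>i S\<close> increase, and their traces on \<open>D\<close> become stationary.\<close>

lemma lying_over_subset:
  assumes N: "ideal N (K\<lparr>carrier := S\<rparr>)" and ND: "N \<inter> D = M" and a: "a \<in> N"
  shows "a \<in> Mloc"
proof (rule ccontr)
  assume aM: "a \<notin> Mloc"
  note N = ideal_subringD[OF N]
  have aS: "a \<in> S" using N a by auto
  have aK: "a \<in> carrier K" using aS S_carrier by auto
  have a0: "a \<noteq> \<zero>"
    using aM M_ideal(2) M.one_notin subringE(3)[OF D] MlocI[of \<zero> \<one>] by auto
  let ?w = "inv a"
  note ia = nonzero_inv[OF aK a0]
  have "inv ?w = a" using ia aK inv_unique' by (metis)
  \<comment> \<open>The dichotomy for 1/a: if it were outside \<open>V\<close>, its inverse a would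
    lie in \<open>Mloc\<close>.\<close>
  then have "?w \<in> V" using V_dichotomy(2)[of ?w] ia aM by auto
  define f where "f i = {d \<in> D. \<exists>y\<in>S. d = x \<otimes> ?w [^] i \<otimes> y}" for i :: nat
  have fid: "ideal (f i) (K\<lparr>carrier := D\<rparr>)" for i
  proof (rule ideal_subringI[OF D])
    have xw: "x \<otimes> ?w [^] i \<in> carrier K" using x_carrier ia by simp
    show "f i \<subseteq> D" by (auto simp: f_def)
    show "\<zero> \<in> f i" using subringE(2)[OF D] subringE(2)[OF S] xw by (auto simp: f_def intro!: bexI[of _ \<zero>])
    show "c \<oplus> d \<in> f i" if h: "c \<in> f i" "d \<in> f i" for c d
    proof -
      obtain y z where yz: "y \<in> S" "c = x \<otimes> ?w [^] i \<otimes> y" "z \<in> S" "d = x \<otimes> ?w [^] i \<otimes> z" "c \<in> D" "d \<in> D"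
        using h unfolding f_def by blast
      have "c \<oplus> d = x \<otimes> ?w [^] i \<otimes> (y \<oplus> z)"
        unfolding yz(2,4) using yz(1,3) S_carrier xw by (simp add: r_distr)
      then show ?thesis unfolding f_def using yz(1,3,5,6) subringE(7)[OF D] subringE(7)[OF S] by blast
    qed
    show "e \<otimes> d \<in> f i" if h: "d \<in> f i" "e \<in> D" for d e
    proof -
      obtain y where y: "y \<in> S" "d = x \<otimes> ?w [^] i \<otimes> y" "d \<in> D" using h unfolding f_def by blast
      have "e \<otimes> d = x \<otimes> ?w [^] i \<otimes> (e \<otimes> y)"
        unfolding y(2) using y(1) S_carrier D_carrier[OF h(2)] xw by (intro m_lcomm) auto
      then show ?thesis unfolding f_def using y h(2) DS subringE(6)[OF D] subringE(6)[OF S] by blast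
    qed
  qed
  have finc: "f i \<subseteq> f (Suc i)" for i
  proof
    fix d assume "d \<in> f i"
    then obtain y where y: "y \<in> S" "d = x \<otimes> ?w [^] i \<otimes> y" "d \<in> D" unfolding f_def by blast
    have "x \<otimes> ?w [^] Suc i \<otimes> (a \<otimes> y) = x \<otimes> ?w [^] i \<otimes> (?w \<otimes> a) \<otimes> y"
      using y(1) S_carrier aK ia(1) x_carrier by (simp add: m_assoc)
    then have "d = x \<otimes> ?w [^] Suc i \<otimes> (a \<otimes> y)"
      using y ia x_carrier by simp
    then show "d \<in> f (Suc i)" unfolding f_def using y aS subringE(6)[OF S] by blast
  qed
  obtain i where i: "f (Suc i) = f i" by (rule R.ideal_sequence_stable[of f, OF fid finc])
  \<comment> \<open>By \<open>V_pow\<close> a multiple s x w^(i+1) lies in \<open>D\<close>, hence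
    in f (i+1) = f i. Cancelling x w^i gives s w in \<open>S\<close>, so s is a multiple of a and
    lies in the contraction \<open>M\<close> of \<open>N\<close>.\<close>
  obtain s where s: "s \<in> D - M" "s \<otimes> (x \<otimes> ?w [^] Suc i) \<in> M"
    using V_pow[OF \<open>?w \<in> V\<close>, of i] by (rule MlocE)
  have sK: "s \<in> carrier K" using s D_carrier by auto
  have "s \<otimes> (x \<otimes> ?w [^] Suc i) = x \<otimes> ?w [^] Suc i \<otimes> s" using sK x_carrier ia by (simp add: m_ac)
  then have "s \<otimes> (x \<otimes> ?w [^] Suc i) \<in> f (Suc i)"
    unfolding f_def using s M_ideal(1) DS by blast
  then obtain y where y: "y \<in> S" "s \<otimes> (x \<otimes> ?w [^] Suc i) = x \<otimes> ?w [^] i \<otimes> y" unfolding i unfolding f_def by blast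
  have yK: "y \<in> carrier K" using y S_carrier by auto
  have wi: "x \<otimes> ?w [^] i \<in> carrier K" "x \<otimes> ?w [^] i \<noteq> \<zero>"
  proof -
    have "?w [^] i \<noteq> \<zero>" by (induction i) (use ia integral in auto)
    then show "x \<otimes> ?w [^] i \<in> carrier K" "x \<otimes> ?w [^] i \<noteq> \<zero>"
      using ia x_carrier x_nonzero integral by auto
  qed
  have "x \<otimes> ?w [^] i \<otimes> (?w \<otimes> s) = x \<otimes> ?w [^] i \<otimes> y"
    unfolding y(2)[symmetric] using sK x_carrier ia(1) by (simp add: m_ac)
  then have "?w \<otimes> s = y" using m_lcancel[OF wi(2,1)] ia(1) sK yK by simp
  then have "s = a \<otimes> y" using ia aK sK by (metis m_assoc l_one)
  then have "s \<in> N" using N(5)[OF a y(1)] by simp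
  then show False using s ND by auto
qed

end

section \<open>Transfer of the local condition\<close>

context noetherian_overring
begin

text \<open>By \<open>lying_over_subset\<close> every element of \<open>N\<close> is carried into
  \<open>M\<close> by some s in D - M, a unit at \<open>N\<close>. Since M^2 lies in N^2, which
  allows cancellation of such s, an element y of N - N^2 goes to one of M - M^2, where the condition
  in \<open>D\<close> applies.\<close>

lemma overring_locally_pseudo_valuation: "locally_pseudo_valuation (K\<lparr>carrier := S\<rparr>)"
  unfolding locally_pseudo_valuation_def
proof (intro allI impI ballI)
  fix N y
  assume mN: "maximalideal N (K\<lparr>carrier := S\<rparr>)" and N0: "N \<noteq> {\<zero>\<^bsub>K\<lparr>carrier := S\<rparr>\<^esub>}"
    and y: "y \<in> N - ideal_prod (K\<lparr>carrier := S\<rparr>) N N"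
  interpret N: primeideal N "K\<lparr>carrier := S\<rparr>" by (rule T.maximalideal_prime[OF mN])
  note Nid = ideal_subringD[OF N.is_ideal]
  let ?R = "K\<lparr>carrier := D\<rparr>" and ?T = "K\<lparr>carrier := S\<rparr>"
  define M where "M = N \<inter> D"
  have Mid: "ideal M ?R"
    unfolding M_def
    by (rule ideal_subringI[OF D]) (use Nid DS subringE[OF D] in auto)
  have Mprime: "primeideal M ?R"
  proof (rule primeidealI[OF Mid R.is_cring])
    show "carrier ?R \<noteq> M" using N.one_notin subringE(3)[OF D] by (auto simp: M_def)
    show "a \<in> M \<or> b \<in> M" if "a \<in> carrier ?R" "b \<in> carrier ?R" "a \<otimes>\<^bsub>?R\<^esub> b \<in> M" for a b
      using N.I_prime[of a b] that DS by (auto simp: M_def)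
  qed
  \<comment> \<open>Clearing the denominator of a nonzero element of \<open>N\<close> gives a
    nonzero element of \<open>D\<close> in \<open>N\<close>.\<close>
  have M0: "M \<noteq> {\<zero>}"
  proof -
    obtain a where a: "a \<in> N" "a \<noteq> \<zero>" using N0 Nid(2) by auto
    have aK: "a \<in> carrier K" using a Nid(1) S_carrier by auto
    obtain b c where bc: "b \<in> D" "c \<in> D" "c \<noteq> \<zero>" "a \<otimes> c = b" using fractionE[OF aK] by metis
    have "b \<in> N" using Nid(5)[OF a(1), of c] bc DS by auto
    moreover have "b \<noteq> \<zero>" using bc a aK integral[of a c] D_carrier by auto
    ultimately show ?thesis using bc by (auto simp: M_def)
  qed
  have Mmax: "maximalideal M ?R"
    using R.nonzero_prime_maximal[OF lpv Mprime] M0 by simp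
  obtain x where x: "x \<in> M - ideal_prod ?R M M"
    using R.prime_square_proper[OF Mprime] M0 by auto
  interpret noetherian_overring_at K D S M x
    by (intro noetherian_overring_at.intro noetherian_overring_at_axioms.intro noetherian_overring_axioms Mmax M0 x)
  have Mloc: "\<exists>s\<in>D - M. s \<otimes> a \<in> M" if "a \<in> N" for a
    using lying_over_subset[OF N.is_ideal M_def[symmetric] that] unfolding Mloc_def by blast
  have NN: "ideal (ideal_prod ?T N N) ?T" by (rule T.ideal_prod_is_ideal[OF N.is_ideal N.is_ideal])
  have yS: "y \<in> S" using y Nid(1) by auto
  have sub: "ideal_prod ?R M M \<subseteq> ideal_prod ?T N N"
  proof
    fix z assume "z \<in> ideal_prod ?R M M"
    then show "z \<in> ideal_prod ?T N N"
    proof induction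
      case (prod i j)
      then show ?case using ideal_prod.prod[of i N j N ?T] by (simp add: M_def)
    next
      case (sum z1 z2)
      then show ?case using ideal_prod.sum[of z1 ?T N N z2] by simp
    qed
  qed
  obtain s where s: "s \<in> D - M" "s \<otimes> y \<in> M" using Mloc y by blast
  have sN: "s \<in> S" "s \<notin> N" using s DS by (auto simp: M_def)
  have "s \<otimes> y \<notin> ideal_prod ?R M M"
  proof
    assume "s \<otimes> y \<in> ideal_prod ?R M M"
    then have "s \<otimes> y \<in> ideal_prod ?T N N" using sub by auto
    then have "y \<in> ideal_prod ?T N N"
      using T.mem_of_mult_mem[OF mN _ _ NN, of s 2 y] sN yS by (simp add: T.ideal_pow_two N.is_ideal)
    then show False using y by simp
  qed
  then have sy: "s \<otimes> y \<in> M - ideal_prod ?R M M" using s by auto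
  show "ideal_prod ?T N N \<subseteq> saturation ?T N (PIdl\<^bsub>?T\<^esub> y)"
  proof (rule T.ideal_prod_subset)
    show "ideal (saturation ?T N (PIdl\<^bsub>?T\<^esub> y)) ?T"
      by (intro N.saturation_ideal T.cgenideal_ideal) (simp add: yS)
    fix a b assume a: "a \<in> N" and b: "b \<in> N"
    obtain s1 where s1: "s1 \<in> D - M" "s1 \<otimes> a \<in> M" using Mloc a by blast
    obtain s2 where s2: "s2 \<in> D - M" "s2 \<otimes> b \<in> M" using Mloc b by blast
    \<comment> \<open>Any element of M - M^2 may take the place of \<open>x\<close> in
      \<open>cofactor\<close>; taking s y makes the result a multiple of \<open>y\<close>.\<close>
    obtain u q where u: "u \<in> D - M" "q \<in> M" "u \<otimes> ((s1 \<otimes> a) \<otimes> (s2 \<otimes> b)) = (s \<otimes> y) \<otimes> q"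
      using cofactor[OF sy square_mem[OF s1(2) s2(2)]] .
    have c: "a \<in> carrier K" "b \<in> carrier K" "s1 \<in> carrier K" "s2 \<in> carrier K" "u \<in> carrier K"
      "q \<in> carrier K" "s \<in> carrier K" "y \<in> carrier K"
      using a b s s1 s2 u yS Nid(1) S_carrier D_carrier M_carrier by auto
    have "(u \<otimes> s1 \<otimes> s2) \<otimes> (a \<otimes> b) = u \<otimes> ((s1 \<otimes> a) \<otimes> (s2 \<otimes> b))"
      using c by (simp add: m_ac)
    also have "\<dots> = (s \<otimes> q) \<otimes> y" unfolding u(3) using c by (simp add: m_ac)
    finally have eq: "(u \<otimes> s1 \<otimes> s2) \<otimes> (a \<otimes> b) = (s \<otimes> q) \<otimes> y" .
    have "s \<otimes> q \<in> S" using sN(1) u(2) by (intro subringE(6)[OF S]) (auto simp: M_def Nid(1)[THEN subsetD])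
    then have "(u \<otimes> s1 \<otimes> s2) \<otimes> (a \<otimes> b) \<in> PIdl\<^bsub>?T\<^esub> y"
      unfolding eq by (auto simp: cgenideal_def)
    moreover have "u \<otimes> s1 \<otimes> s2 \<in> D - M" by (intro mult_notin_M u s1 s2)
    then have "u \<otimes> s1 \<otimes> s2 \<in> S - N" using DS by (auto simp: M_def)
    moreover have "a \<otimes> b \<in> S" using a b Nid(1) by (intro subringE(6)[OF S]) auto
    ultimately show "a \<otimes>\<^bsub>?T\<^esub> b \<in> saturation ?T N (PIdl\<^bsub>?T\<^esub> y)"
      by (intro N.saturation_memI[of _ "u \<otimes> s1 \<otimes> s2"]) auto
  qed
qed

end

theorem corollary4p7:
  fixes K :: "('a, 'b) ring_scheme" and D :: "'a set"
  assumes "is_quotient_field K D"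
    and "noetherian_domain (K\<lparr>carrier := D\<rparr>)"
    and "TAF_domain (K\<lparr>carrier := D\<rparr>)"
  shows "\<forall>S. overring K D S \<longrightarrow>
           noetherian_domain (K\<lparr>carrier := S\<rparr>) \<and> TAF_domain (K\<lparr>carrier := S\<rparr>)"
proof (intro allI impI)
  fix S assume S: "overring K D S"
  have "field K" and "subring S K" and "D \<subseteq> S"
    using S by (simp_all add: overring_def is_quotient_field_def)
  then interpret noetherian_overring K D S
    by (intro noetherian_overring.intro noetherian_overring_axioms.intro assms(1,2)
        TAF_domain_imp_locally_pseudo_valuation[OF assms(2,3)])
  have "TAF_domain (K\<lparr>carrier := S\<rparr>)"
    by (rule noetherian_domain.locally_pseudo_valuation_imp_TAF_domain
          [OF overring_noetherian overring_locally_pseudo_valuation])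
  then show "noetherian_domain (K\<lparr>carrier := S\<rparr>) \<and> TAF_domain (K\<lparr>carrier := S\<rparr>)"
    using overring_noetherian by simp
qed

end
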